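(* Let $G$ be a connected $d$-regular Lichnerowicz-sharp graph. Assume that $m_2(G)\ge d-m$ for some positive integer $m\le \frac d2$. Then $G\cong B\,\square\,H_{d-2m+1}$ for some connected $(2m-1)$-regular graph $B$. Moreover, $B$ also satisfies $\mathrm{CD}(2,\infty)$, and $m_2(B)\ge m-1$.
   Context: All graphs are simple, finite, connected and unweighted. For $f:V(G)\to\mathbb{R}$ put $Lf(x)=\sum_{y\sim x}(f(y)-f(x))$. The eigenvalues of $-L$ are $0=\lambda_0<\lambda_1\le\lambda_2\le\cdots$, counted with multiplicity, and $m_2(G)=\dim\ker(L+2I)$ is the multiplicity of the eigenvalue $2$ of $-L$ (possibly $0$). The Bakry--Émery operators are $2\Gamma(f,g)=L(fg)-fLg-gLf$ and $2\Gamma_2(f,g)=L\Gamma(f,g)-\Gamma(f,Lg)-\Gamma(g,Lf)$, with $\Gamma(f)=\Gamma(f,f)$ and $\Gamma_2(f)=\Gamma_2(f,f)$. $G$ satisfies $\mathrm{CD}(K,\infty)$ if $\Gamma_2(f)(x)\ge K\,\Gamma(f)(x)$ for all $f:V(G)\to\mathbb{R}$ and all $x\in V(G)$. $G$ is Lichnerowicz-sharp if, for some $K>0$, it satisfies $\mathrm{CD}(K,\infty)$ and $\lambda_1(G)=K$. $H_r$ is the $r$-dimensional hypercube: vertex set $\mathbb{F}_2^r$, two vertices adjacent iff they differ in exactly one coordinate ($H_0$ is the one-vertex graph). $\square$ denotes the Cartesian product of graphs. *)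

theory Defs
  imports
    Complex_Main
    "HOL-Library.FuncSet"
    "HOL-Library.Function_Algebras"
    "HOL-Library.Multiset"
    "HOL-Library.Z2"
    "Graph_Theory.Graph_Theory"
begin

text \<open>
  A finite simple graph is a \<^locale>\<open>pair_graph\<close>: a finite set of vertices with a symmetric,
  irreflexive set of arcs.  Each undirected edge \<open>{x, y}\<close> is given by the two arcs \<open>(x, y)\<close>
  and \<open>(y, x)\<close>, so the degree of a vertex is its out-degree.
\<close>

definition regular_graph :: "nat \<Rightarrow> 'a pair_pre_digraph \<Rightarrow> bool" where
  "regular_graph d G \<longleftrightarrow> (\<forall>x\<in>pverts G. out_degree (with_proj G) x = d)"

definition cartesian_product ::
    "'a pair_pre_digraph \<Rightarrow> 'b pair_pre_digraph \<Rightarrow> ('a \<times> 'b) pair_pre_digraph" where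
  "cartesian_product G H =
     \<lparr> pverts = pverts G \<times> pverts H,
       parcs = {((x, u), (y, v)). x \<in> pverts G \<and> y \<in> pverts G \<and> u \<in> pverts H \<and> v \<in> pverts H \<and>
                 (x = y \<and> (u, v) \<in> parcs H \<or> (x, y) \<in> parcs G \<and> u = v)} \<rparr>"

definition hypercube :: "nat \<Rightarrow> (nat \<Rightarrow> bit) pair_pre_digraph" where
  "hypercube r =
     \<lparr> pverts = {..<r} \<rightarrow>\<^sub>E (UNIV :: bit set),
       parcs = {(x, y). x \<in> {..<r} \<rightarrow>\<^sub>E UNIV \<and> y \<in> {..<r} \<rightarrow>\<^sub>E UNIV \<and>
                 (\<exists>!i. i < r \<and> x i \<noteq> y i)} \<rparr>"

text \<open>
  Real functions on the vertex set are functions on the whole type \<^typ>\<open>'a\<close>; the operators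
  below, evaluated at a vertex, depend only on the values at vertices.
\<close>

definition laplacian :: "'a pair_pre_digraph \<Rightarrow> ('a \<Rightarrow> real) \<Rightarrow> 'a \<Rightarrow> real" where
  "laplacian G f x = (\<Sum>y | (x, y) \<in> parcs G. f y - f x)"

definition Gamma ::
    "'a pair_pre_digraph \<Rightarrow> ('a \<Rightarrow> real) \<Rightarrow> ('a \<Rightarrow> real) \<Rightarrow> 'a \<Rightarrow> real" where
  "Gamma G f g x =
     (laplacian G (\<lambda>y. f y * g y) x - f x * laplacian G g x - g x * laplacian G f x) / 2"

definition Gamma2 ::
    "'a pair_pre_digraph \<Rightarrow> ('a \<Rightarrow> real) \<Rightarrow> ('a \<Rightarrow> real) \<Rightarrow> 'a \<Rightarrow> real" where
  "Gamma2 G f g x =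
     (laplacian G (Gamma G f g) x - Gamma G f (laplacian G g) x - Gamma G g (laplacian G f) x) / 2"

text \<open>The curvature-dimension inequality \<open>CD(K, \<infinity>)\<close>.\<close>

definition CD_inf :: "'a pair_pre_digraph \<Rightarrow> real \<Rightarrow> bool" where
  "CD_inf G K \<longleftrightarrow> (\<forall>f. \<forall>x\<in>pverts G. Gamma2 G f f x \<ge> K * Gamma G f f x)"

text \<open>
  \<open>ker (L + l I)\<close>, the eigenspace of \<open>-L\<close> for \<open>l\<close>.  Functions on the vertex set are represented
  by their extension by \<open>0\<close>, so that the dimension is not affected by values outside the graph.
\<close>

definition eigenspace :: "'a pair_pre_digraph \<Rightarrow> real \<Rightarrow> ('a \<Rightarrow> real) set" where
  "eigenspace G l =
     {f. (\<forall>x. x \<notin> pverts G \<longrightarrow> f x = 0) \<and> (\<forall>x\<in>pverts G. laplacian G f x + l * f x = 0)}"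

definition fun_scale :: "real \<Rightarrow> ('a \<Rightarrow> real) \<Rightarrow> 'a \<Rightarrow> real" where
  "fun_scale c f = (\<lambda>x. c * f x)"

lemma vector_space_fun_scale: "vector_space fun_scale"
  by unfold_locales (auto simp: fun_scale_def fun_eq_iff algebra_simps)

definition eigen_mult :: "'a pair_pre_digraph \<Rightarrow> real \<Rightarrow> nat" where
  "eigen_mult G l = vector_space.dim fun_scale (eigenspace G l)"

text \<open>The eigenvalues of \<open>-L\<close> with multiplicity; only finitely many \<open>l\<close> contribute for a finite graph.\<close>

definition spectrum_mset :: "'a pair_pre_digraph \<Rightarrow> real multiset" where
  "spectrum_mset G = (\<Sum>l | eigen_mult G l > 0. replicate_mset (eigen_mult G l) l)"

text \<open>\<open>\<lambda>\<^sub>k\<close>, counted from \<open>k = 0\<close>; meaningful only if \<open>k\<close> is less than the number of vertices.\<close>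

definition laplacian_eigenvalue :: "'a pair_pre_digraph \<Rightarrow> nat \<Rightarrow> real" where
  "laplacian_eigenvalue G k = sorted_list_of_multiset (spectrum_mset G) ! k"

text \<open>The cardinality condition says that \<open>\<lambda>\<^sub>1\<close> exists.\<close>

definition lichnerowicz_sharp :: "'a pair_pre_digraph \<Rightarrow> bool" where
  "lichnerowicz_sharp G \<longleftrightarrow>
     card (pverts G) > 1 \<and> (\<exists>K>0. CD_inf G K \<and> laplacian_eigenvalue G 1 = K)"

end

theory Submission
  imports Defs
begin

text \<open>
  Let \<open>A\<close> be the adjacency matrix and let \<open>E\<close> be the eigenspace of \<open>-L\<close> for the eigenvalue 2.
  If \<open>f\<close> is an eigenfunction whose eigenvalue \<open>K\<close> is the curvature bound, the nonnegative quantities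
  \<open>\<Gamma>\<^sub>2(f) - K \<Gamma>(f)\<close> sum to zero over the vertices.  So \<open>f\<close> lies in the kernel of all these
  quadratic forms, and written out entry by entry this is the commutator identity
  \<open>[A, [A, f]] = 2 K f\<close>, with functions read as diagonal matrices (\<open>sharp_midpoint\<close>).  Summing
  a row gives \<open>K\<^sup>2 f = 2 K f\<close>, hence \<open>K = 2\<close>.

  For \<open>f \<in> E\<close> the identity has two consequences.  The form \<open>\<Gamma>(f)\<close> is constant, so \<open>f\<close> is determined
  by its jumps at any one vertex.  The matrix of squared jumps \<open>(f y - f x)\<^sup>2\<close> commutes with \<open>A\<close>, so
  the sum of cubed jumps is again in \<open>E\<close> (\<open>cubic_jumps_in_E\<close>).

  The heart of the matter is what happens at a local minimum \<open>x\<close> of \<open>f \<in> E\<close>.  Testing the curvature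
  condition on spikes along the edges at \<open>x\<close>, and comparing with a moment identity for the numbers of
  common neighbours, one finds that in the directions where \<open>f\<close> grows the graph looks like a cube:
  every edge \<open>x w\<close> with \<open>f w > f x\<close> spans exactly one square with every other edge at \<open>x\<close>
  (\<open>local_min_codeg\<close>, \<open>unique_square\<close>).  The jumps of every \<open>g \<in> E\<close> are transported along these
  squares, and therefore \<open>- 1/2\<close> times its sum of cubed jumps has at \<open>x\<close> the cubes of the jumps of
  \<open>g\<close> (\<open>cubic_jumps_step\<close>).  If \<open>f\<close> is generic, the jumps at \<open>x\<close> of the functions in \<open>E\<close> form a space
  closed under cubing; such a space contains the indicator function of every maximal block of
  neighbours on which all its members are constant and not zero (\<open>cube_closed_indicator\<close>).  Since
  \<open>2 dim E \<ge> d\<close>, counting gives a block with one or two elements (\<open>ex_small_twin_block\<close>).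

  A function \<open>f \<in> E\<close> whose jumps at one vertex are the indicator of a block of size \<open>r \<le> 2\<close> takes only
  \<open>r + 1\<close> values.  The graph fibres over the lowest level set \<open>B\<close>, and the projection intertwines
  the Laplacians (\<open>laplacian_lift\<close>).  So \<open>B\<close> is a connected \<open>(d - r)\<close>-regular graph satisfying
  \<open>CD(2, \<infinity>)\<close>, and the multiplicity of 2 drops by at most one.  For \<open>r = 1\<close> the graph is the product
  of \<open>B\<close> with an edge.  A block of size one always exists: if the block has size two, induction on the
  degree produces one on \<open>B\<close>, and it lifts (\<open>ex_unit_block\<close>).  As long as \<open>d \<ge> 2 m\<close> the hypothesis on the
  multiplicity therefore splits off an edge and is preserved with \<open>d - 1\<close> in place of \<open>d\<close>, so this
  happens \<open>d - 2 m + 1\<close> times.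
\<close>

section \<open>Regular graphs and the Laplacian\<close>

definition nbrs :: "'a pair_pre_digraph \<Rightarrow> 'a \<Rightarrow> 'a set" where
  "nbrs G x = {y. (x, y) \<in> parcs G}"

lemma laplacian_nbrs: "laplacian G f x = (\<Sum>y\<in>nbrs G x. f y - f x)"
  by (simp add: laplacian_def nbrs_def)

text \<open>
  Connectedness is stated as the absence of proper nonempty sets of vertices closed under adjacency:
  in this form it proves that a property which spreads along edges holds at every vertex.
\<close>

locale connected_regular_graph =
  fixes G :: "'a pair_pre_digraph" and d :: nat
  assumes finite_verts: "finite (pverts G)"
    and verts_nonempty: "pverts G \<noteq> {}"
    and nbrs_subset: "nbrs G x \<subseteq> pverts G"
    and nbrs_dom: "y \<in> nbrs G x \<Longrightarrow> x \<in> pverts G"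
    and nbrs_sym: "y \<in> nbrs G x \<Longrightarrow> x \<in> nbrs G y"
    and nbrs_irrefl: "x \<notin> nbrs G x"
    and card_nbrs: "x \<in> pverts G \<Longrightarrow> card (nbrs G x) = d"
    and closed_imp_all: "S \<subseteq> pverts G \<Longrightarrow> S \<noteq> {} \<Longrightarrow> (\<And>x. x \<in> S \<Longrightarrow> nbrs G x \<subseteq> S) \<Longrightarrow> S = pverts G"
begin

abbreviation "V \<equiv> pverts G"
abbreviation "N \<equiv> nbrs G"
abbreviation "L \<equiv> laplacian G"

lemma finite_nbrs [simp]: "finite (N x)"
  using finite_subset[OF nbrs_subset finite_verts] .

lemma nbrs_in_verts: "y \<in> N x \<Longrightarrow> y \<in> V"
  using nbrs_subset by auto

lemma laplacian_eq: "x \<in> V \<Longrightarrow> L f x = (\<Sum>y\<in>N x. f y) - real d * f x"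
  by (simp add: laplacian_nbrs sum_subtractf card_nbrs)

lemma laplacian_cong:
  assumes "x \<in> V" "\<And>y. y \<in> V \<Longrightarrow> f y = g y"
  shows "L f x = L g x"
  using assms nbrs_in_verts by (auto simp: laplacian_nbrs intro!: sum.cong)

lemma laplacian_add: "L (\<lambda>y. f y + g y) x = L f x + L g x"
  by (simp add: laplacian_nbrs algebra_simps sum.distrib sum_subtractf)

lemma laplacian_scale: "L (\<lambda>y. c * f y) x = c * L f x"
  by (simp add: laplacian_nbrs algebra_simps sum_distrib_left)

lemma two_step_sum:
  fixes F :: "'a \<Rightarrow> 'a \<Rightarrow> real"
  shows "(\<Sum>y\<in>N x. \<Sum>z\<in>N y. F y z) = (\<Sum>z\<in>V. \<Sum>y\<in>N x \<inter> N z. F y z)"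
proof -
  have "(\<Sum>y\<in>N x. \<Sum>z\<in>N y. F y z) = (\<Sum>y\<in>N x. \<Sum>z | z \<in> V \<and> z \<in> N y. F y z)"
    by (intro sum.cong refl) (use nbrs_in_verts in auto)
  also have "\<dots> = (\<Sum>z\<in>V. \<Sum>y | y \<in> N x \<and> z \<in> N y. F y z)"
    by (rule sum.swap_restrict) (use finite_verts in auto)
  also have "\<dots> = (\<Sum>z\<in>V. \<Sum>y\<in>N x \<inter> N z. F y z)"
    by (intro sum.cong refl) (use nbrs_sym in auto)
  finally show ?thesis .
qed

lemma edge_sum_swap:
  fixes F :: "'a \<Rightarrow> 'a \<Rightarrow> real"
  shows "(\<Sum>x\<in>V. \<Sum>y\<in>N x. F x y) = (\<Sum>x\<in>V. \<Sum>y\<in>N x. F y x)"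
proof -
  have "(\<Sum>x\<in>V. \<Sum>y\<in>N x. F x y) = (\<Sum>x\<in>V. \<Sum>y | y \<in> V \<and> y \<in> N x. F x y)"
    by (intro sum.cong refl) (use nbrs_in_verts in auto)
  also have "\<dots> = (\<Sum>y\<in>V. \<Sum>x | x \<in> V \<and> y \<in> N x. F x y)"
    by (rule sum.swap_restrict) (use finite_verts in auto)
  also have "\<dots> = (\<Sum>y\<in>V. \<Sum>x\<in>N y. F x y)"
    by (intro sum.cong refl) (use nbrs_sym nbrs_in_verts in auto)
  finally show ?thesis .
qed

lemma sum_laplacian: "(\<Sum>x\<in>V. L f x) = 0"
proof -
  have "(\<Sum>x\<in>V. L f x) = (\<Sum>x\<in>V. \<Sum>y\<in>N x. f x - f y)"
    unfolding laplacian_nbrs by (rule edge_sum_swap)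
  also have "\<dots> = - (\<Sum>x\<in>V. L f x)"
    by (simp add: laplacian_nbrs sum_subtractf)
  finally show ?thesis by simp
qed

lemma Gamma_eq: "Gamma G f g x = (\<Sum>y\<in>N x. (f y - f x) * (g y - g x)) / 2"
proof -
  have "laplacian G (\<lambda>y. f y * g y) x - f x * L g x - g x * L f x
      = (\<Sum>y\<in>N x. (f y * g y - f x * g x) - f x * (g y - g x) - g x * (f y - f x))"
    unfolding laplacian_nbrs sum_distrib_left by (simp only: sum_subtractf)
  also have "\<dots> = (\<Sum>y\<in>N x. (f y - f x) * (g y - g x))"
    by (intro sum.cong refl) (simp add: algebra_simps)
  finally show ?thesis by (simp add: Gamma_def)
qed

lemma Gamma_cong:
  assumes v: "v \<in> V" and "\<And>y. y \<in> V \<Longrightarrow> h y = h' y" and "\<And>y. y \<in> V \<Longrightarrow> k y = k' y"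
  shows "Gamma G h k v = Gamma G h' k' v"
  unfolding Gamma_eq using assms nbrs_in_verts by (auto intro!: sum.cong)

lemma Gamma_commute: "Gamma G f g x = Gamma G g f x"
  by (simp add: Gamma_eq mult.commute)

lemma Gamma2_commute: "Gamma2 G f g x = Gamma2 G g f x"
proof -
  have "Gamma G f g = Gamma G g f" using Gamma_commute by auto
  then show ?thesis by (simp add: Gamma2_def)
qed

text \<open>
  Only the values of \<open>g\<close> relative to \<open>g x\<close> matter, and they enter linearly, so the form can be written
  as a sum over the vertices \<open>z\<close> with coefficients depending on \<open>f\<close>.  The coefficient of a vertex at
  distance two from \<open>x\<close> is the defect of the midpoint rule for \<open>f\<close> on the common neighbours.
\<close>

lemma Gamma2_formula:
  assumes x: "x \<in> V"
  shows "4 * (Gamma2 G f g x - K * Gamma G f g x) =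
      (\<Sum>z\<in>V. (g z - g x) * (\<Sum>y\<in>N x \<inter> N z. f x + f z - 2 * f y))
    + (\<Sum>y\<in>N x. (g y - g x) * (2 * L f x - 2 * L f y - 2 * K * (f y - f x)))"
proof -
  \<comment> \<open>Normalising both functions to vanish at \<open>x\<close> turns both sides into sums over walks \<open>x, y, z\<close>,
    which are then compared term by term.\<close>
  define F where "F z = f z - f x" for z
  define H where "H z = g z - g x" for z
  have d: "(\<Sum>z\<in>N y. c) = real d * c" if "y \<in> N x" for y and c :: real
    using card_nbrs[OF nbrs_in_verts[OF that]] by simp
  have dx: "(\<Sum>z\<in>N x. c) = real d * c" for c :: real
    using card_nbrs[OF x] by simp
  have Lf: "L f y = (\<Sum>z\<in>N y. F z - F y)" for y
    by (simp add: laplacian_nbrs F_def)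
  have Lg: "L g y = (\<Sum>z\<in>N y. H z - H y)" for y
    by (simp add: laplacian_nbrs H_def)
  have Lfx: "L f x = sum F (N x)" by (simp add: Lf F_def)
  have Lgx: "L g x = sum H (N x)" by (simp add: Lg H_def)
  have G1: "2 * Gamma G f g y = (\<Sum>z\<in>N y. (F z - F y) * (H z - H y))" for y
    by (simp add: Gamma_eq F_def H_def)
  have G1x: "2 * Gamma G f g x = (\<Sum>y\<in>N x. F y * H y)"
    by (simp add: Gamma_eq F_def H_def)
  have LG: "2 * L (Gamma G f g) x = (\<Sum>y\<in>N x. \<Sum>z\<in>N y. (F z - F y) * (H z - H y))
      - real d * (\<Sum>y\<in>N x. F y * H y)"
  proof -
    have "2 * L (Gamma G f g) x = (\<Sum>y\<in>N x. 2 * Gamma G f g y) - real d * (2 * Gamma G f g x)"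
      using laplacian_eq[OF x, of "Gamma G f g"] by (simp add: sum_distrib_left [symmetric])
    then show ?thesis unfolding G1x by (simp only: G1)
  qed
  have GL1: "2 * Gamma G f (L g) x = (\<Sum>y\<in>N x. F y * (L g y - L g x))"
    by (simp add: Gamma_eq F_def)
  have GL2: "2 * Gamma G g (L f) x = (\<Sum>y\<in>N x. H y * (L f y - L f x))"
    by (simp add: Gamma_eq H_def)
  have four: "4 * Gamma2 G f g x = (\<Sum>y\<in>N x. \<Sum>z\<in>N y. (F z - F y) * (H z - H y))
      - real d * (\<Sum>y\<in>N x. F y * H y) - (\<Sum>y\<in>N x. F y * (L g y - L g x))
      - (\<Sum>y\<in>N x. H y * (L f y - L f x))"
    unfolding Gamma2_def using LG GL1 GL2 by simp
  have a1: "real d * (\<Sum>y\<in>N x. F y * H y) = (\<Sum>y\<in>N x. \<Sum>z\<in>N y. F y * H y)"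
    unfolding sum_distrib_left by (intro sum.cong refl) (simp only: d)
  have a2: "(\<Sum>y\<in>N x. F y * (L g y - L g x))
      = (\<Sum>y\<in>N x. \<Sum>z\<in>N y. F y * (H z - H y)) - sum F (N x) * sum H (N x)"
  proof -
    have "(\<Sum>y\<in>N x. F y * (L g y - L g x)) = (\<Sum>y\<in>N x. F y * L g y) - sum F (N x) * L g x"
      by (simp only: right_diff_distrib sum_subtractf sum_distrib_right)
    also have "(\<Sum>y\<in>N x. F y * L g y) = (\<Sum>y\<in>N x. \<Sum>z\<in>N y. F y * (H z - H y))"
      by (simp only: Lg sum_distrib_left)
    finally show ?thesis by (simp only: Lgx)
  qed
  have a3: "(\<Sum>y\<in>N x. H y * (L f y - L f x))
      = (\<Sum>y\<in>N x. \<Sum>z\<in>N y. H y * (F z - F y)) - sum F (N x) * sum H (N x)"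
  proof -
    have "(\<Sum>y\<in>N x. H y * (L f y - L f x)) = (\<Sum>y\<in>N x. H y * L f y) - sum H (N x) * L f x"
      by (simp only: right_diff_distrib sum_subtractf sum_distrib_right)
    also have "(\<Sum>y\<in>N x. H y * L f y) = (\<Sum>y\<in>N x. \<Sum>z\<in>N y. H y * (F z - F y))"
      by (simp only: Lf sum_distrib_left)
    finally show ?thesis by (simp only: Lfx mult.commute)
  qed
  have lhs: "4 * Gamma2 G f g x = (\<Sum>y\<in>N x. \<Sum>z\<in>N y. F z * H z - 2 * F z * H y - 2 * F y * H z + 2 * F y * H y)
      + 2 * (sum F (N x) * sum H (N x))"
  proof -
    have "(\<Sum>y\<in>N x. \<Sum>z\<in>N y. F z * H z - 2 * F z * H y - 2 * F y * H z + 2 * F y * H y)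
        = (\<Sum>y\<in>N x. \<Sum>z\<in>N y. (F z - F y) * (H z - H y)) - (\<Sum>y\<in>N x. \<Sum>z\<in>N y. F y * H y)
        - (\<Sum>y\<in>N x. \<Sum>z\<in>N y. F y * (H z - H y)) - (\<Sum>y\<in>N x. \<Sum>z\<in>N y. H y * (F z - F y))"
      unfolding sum_subtractf[symmetric] by (intro sum.cong refl) (simp add: algebra_simps)
    then show ?thesis unfolding four a1 a2 a3 by simp
  qed
  have b1: "(\<Sum>z\<in>V. (g z - g x) * (\<Sum>y\<in>N x \<inter> N z. f x + f z - 2 * f y))
      = (\<Sum>y\<in>N x. \<Sum>z\<in>N y. H z * (F z - 2 * F y))"
    unfolding two_step_sum by (simp add: sum_distrib_left F_def H_def algebra_simps)
  have b2: "(\<Sum>y\<in>N x. (g y - g x) * (2 * L f x - 2 * L f y - 2 * K * (f y - f x)))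
      = 2 * (sum F (N x) * sum H (N x)) - (\<Sum>y\<in>N x. \<Sum>z\<in>N y. 2 * H y * (F z - F y)) - 2 * K * (\<Sum>y\<in>N x. F y * H y)"
  proof -
    have "(\<Sum>y\<in>N x. (g y - g x) * (2 * L f x - 2 * L f y - 2 * K * (f y - f x)))
       = (\<Sum>y\<in>N x. 2 * (L f x * H y) - 2 * H y * L f y - 2 * K * (F y * H y))"
      by (intro sum.cong refl) (simp add: F_def H_def algebra_simps)
    also have "\<dots> = 2 * (L f x * sum H (N x)) - (\<Sum>y\<in>N x. 2 * H y * L f y) - 2 * K * (\<Sum>y\<in>N x. F y * H y)"
      by (simp add: sum_subtractf sum_distrib_left)
    also have "(\<Sum>y\<in>N x. 2 * H y * L f y) = (\<Sum>y\<in>N x. \<Sum>z\<in>N y. 2 * H y * (F z - F y))"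
      by (simp add: Lf sum_distrib_left)
    finally show ?thesis by (simp add: Lfx)
  qed
  have "4 * Gamma2 G f g x = (\<Sum>y\<in>N x. \<Sum>z\<in>N y. H z * (F z - 2 * F y))
      + (2 * (sum F (N x) * sum H (N x)) - (\<Sum>y\<in>N x. \<Sum>z\<in>N y. 2 * H y * (F z - F y)))"
  proof -
    have "(\<Sum>y\<in>N x. \<Sum>z\<in>N y. F z * H z - 2 * F z * H y - 2 * F y * H z + 2 * F y * H y)
        = (\<Sum>y\<in>N x. \<Sum>z\<in>N y. H z * (F z - 2 * F y)) - (\<Sum>y\<in>N x. \<Sum>z\<in>N y. 2 * H y * (F z - F y))"
      unfolding sum_subtractf[symmetric] by (intro sum.cong refl) (simp add: algebra_simps)
    then show ?thesis unfolding lhs by simp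
  qed
  then show ?thesis
    unfolding b1 b2 using G1x by (simp add: algebra_simps)
qed

end

section \<open>Eigenfunctions at the curvature bound\<close>

context connected_regular_graph begin

definition cd_form :: "real \<Rightarrow> ('a \<Rightarrow> real) \<Rightarrow> ('a \<Rightarrow> real) \<Rightarrow> 'a \<Rightarrow> real" where
  "cd_form K f g x = 4 * (Gamma2 G f g x - K * Gamma G f g x)"

lemma cd_form_commute: "cd_form K f g x = cd_form K g f x"
  by (simp add: cd_form_def Gamma_commute[of f] Gamma2_commute[of f])

lemma cd_form_eq:
  "x \<in> V \<Longrightarrow> cd_form K f g x =
      (\<Sum>z\<in>V. (g z - g x) * (\<Sum>y\<in>N x \<inter> N z. f x + f z - 2 * f y))
    + (\<Sum>y\<in>N x. (g y - g x) * (2 * L f x - 2 * L f y - 2 * K * (f y - f x)))"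
  unfolding cd_form_def by (rule Gamma2_formula)

lemma cd_form_linear:
  assumes "x \<in> V"
  shows "cd_form K h (\<lambda>y. f y + t * g y) x = cd_form K h f x + t * cd_form K h g x"
proof -
  have *: "((f z + t * g z) - (f x + t * g x)) * c = (f z - f x) * c + t * ((g z - g x) * c)" for z c
    by (simp add: algebra_simps)
  have "(\<Sum>z\<in>A. ((f z + t * g z) - (f x + t * g x)) * c z)
      = (\<Sum>z\<in>A. (f z - f x) * c z) + t * (\<Sum>z\<in>A. (g z - g x) * c z)" for A :: "'a set" and c
    unfolding * sum.distrib sum_distrib_left ..
  then show ?thesis
    unfolding cd_form_eq[OF assms] by (simp only: distrib_left add.assoc add.left_commute)
qed

lemma cd_form_nonneg: "CD_inf G K \<Longrightarrow> x \<in> V \<Longrightarrow> 0 \<le> cd_form K f f x"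
  by (simp add: CD_inf_def cd_form_def)

text \<open>
  Under the curvature condition the form at \<open>x\<close> is positive semidefinite, so its quadratic form
  vanishes only on its radical.
\<close>

lemma cd_form_kernel:
  assumes cd: "CD_inf G K" and x: "x \<in> V" and zero: "cd_form K f f x = 0"
  shows "cd_form K f g x = 0"
proof -
  define b where "b = cd_form K f g x"
  define c where "c = cd_form K g g x"
  have c: "0 \<le> c" unfolding c_def by (rule cd_form_nonneg[OF cd x])
  \<comment> \<open>Near the minimiser of \<open>2 t b + t\<^sup>2 c\<close>; the shift by one covers \<open>c = 0\<close>.\<close>
  define t where "t = - b / (c + 1)"
  define h where "h = (\<lambda>y. f y + t * g y)"
  have "cd_form K h h x = cd_form K h f x + t * cd_form K h g x"
    unfolding h_def by (rule cd_form_linear[OF x])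
  moreover have "cd_form K h f x = cd_form K f f x + t * cd_form K f g x"
    unfolding cd_form_commute[of K h f] unfolding h_def by (rule cd_form_linear[OF x])
  moreover have "cd_form K h g x = cd_form K g f x + t * cd_form K g g x"
    unfolding cd_form_commute[of K h g] unfolding h_def by (rule cd_form_linear[OF x])
  ultimately have "0 \<le> 2 * t * b + t\<^sup>2 * c"
    using cd_form_nonneg[OF cd x, of h] zero
    by (simp add: b_def c_def cd_form_commute[of K g f] power2_eq_square algebra_simps)
  also have "2 * t * b + t\<^sup>2 * c = - (b\<^sup>2 * (c + 2) / (c + 1)\<^sup>2)"
  proof -
    have "c + 1 \<noteq> 0" using c by simp
    then have tc: "t * (c + 1) = - b" by (simp add: t_def)
    have "(2 * t * b + t\<^sup>2 * c) * (c + 1)\<^sup>2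
        = 2 * b * (t * (c + 1)) * (c + 1) + c * (t * (c + 1))\<^sup>2"
      by (simp add: power2_eq_square algebra_simps)
    also have "\<dots> = - (b\<^sup>2 * (c + 2))"
      unfolding tc by (simp add: power2_eq_square algebra_simps)
    finally have "(2 * t * b + t\<^sup>2 * c) * (c + 1)\<^sup>2 = - (b\<^sup>2 * (c + 2))" .
    moreover have "X = - (Y / D)" if "X * D = - Y" "D \<noteq> 0" for X Y D :: real
      using that by (simp add: field_simps)
    ultimately show ?thesis using \<open>c + 1 \<noteq> 0\<close> by simp
  qed
  finally have "b\<^sup>2 * (c + 2) / (c + 1)\<^sup>2 \<le> 0" by simp
  then have "b\<^sup>2 * (c + 2) \<le> 0" using c by (simp add: divide_le_0_iff)
  then have "b\<^sup>2 \<le> 0" using c by (simp add: mult_le_0_iff)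
  then show ?thesis by (simp add: b_def)
qed

lemma eigenspace_eq: "f \<in> eigenspace G l \<Longrightarrow> x \<in> V \<Longrightarrow> L f x = - l * f x"
  by (simp add: eigenspace_def eq_neg_iff_add_eq_0)

lemma eigenspace_outside: "f \<in> eigenspace G l \<Longrightarrow> x \<notin> V \<Longrightarrow> f x = 0"
  by (simp add: eigenspace_def)

lemma eigenspaceI:
  "(\<And>x. x \<notin> V \<Longrightarrow> f x = 0) \<Longrightarrow> (\<And>x. x \<in> V \<Longrightarrow> L f x = - l * f x) \<Longrightarrow> f \<in> eigenspace G l"
  by (simp add: eigenspace_def)

lemma eigenspace_add:
  "f \<in> eigenspace G l \<Longrightarrow> g \<in> eigenspace G l \<Longrightarrow> (\<lambda>y. f y + g y) \<in> eigenspace G l"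
  by (intro eigenspaceI) (auto simp: eigenspace_eq eigenspace_outside laplacian_add algebra_simps)

lemma eigenspace_scale:
  "f \<in> eigenspace G l \<Longrightarrow> (\<lambda>y. c * f y) \<in> eigenspace G l"
  by (intro eigenspaceI) (auto simp: eigenspace_eq eigenspace_outside laplacian_scale)

lemma eigenspace_uminus: "f \<in> eigenspace G l \<Longrightarrow> (\<lambda>y. - f y) \<in> eigenspace G l"
  using eigenspace_scale[of f l "-1"] by simp

lemma eigenspace_add_scale:
  "f \<in> eigenspace G l \<Longrightarrow> g \<in> eigenspace G l \<Longrightarrow> (\<lambda>y. f y + c * g y) \<in> eigenspace G l"
  by (rule eigenspace_add[OF _ eigenspace_scale])

lemma eigenspace_diff:
  "f \<in> eigenspace G l \<Longrightarrow> g \<in> eigenspace G l \<Longrightarrow> (\<lambda>y. f y - g y) \<in> eigenspace G l"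
  using eigenspace_add_scale[of f l g "-1"] by simp

text \<open>
  For an eigenfunction the form reduces to \<open>2 L (\<Gamma> f)\<close>, and a Laplacian sums to zero over the graph.
\<close>

lemma sharp_eigenfunction:
  assumes cd: "CD_inf G K" and f: "f \<in> eigenspace G K" and x: "x \<in> V"
  shows "cd_form K f f x = 0" and "L (Gamma G f f) x = 0"
proof -
  have half: "cd_form K f f z = 2 * L (Gamma G f f) z" if z: "z \<in> V" for z
  proof -
    have "Gamma G f (L f) z = - K * Gamma G f f z"
    proof -
      have "(\<Sum>y\<in>N z. (f y - f z) * (L f y - L f z)) = (\<Sum>y\<in>N z. - K * ((f y - f z) * (f y - f z)))"
        by (intro sum.cong refl)
          (simp add: eigenspace_eq[OF f z] eigenspace_eq[OF f nbrs_in_verts] algebra_simps)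
      then show ?thesis unfolding Gamma_eq sum_distrib_left[symmetric] by simp
    qed
    then show ?thesis unfolding cd_form_def Gamma2_def by (simp add: field_simps)
  qed
  have "(\<Sum>z\<in>V. cd_form K f f z) = 2 * (\<Sum>z\<in>V. L (Gamma G f f) z)"
    by (simp add: half sum_distrib_left)
  also have "\<dots> = 0" by (simp add: sum_laplacian)
  finally show *: "cd_form K f f x = 0"
    using cd_form_nonneg[OF cd] finite_verts x by (simp add: sum_nonneg_eq_0_iff)
  show "L (Gamma G f f) x = 0" using half[OF x] * by simp
qed

text \<open>
  The off-diagonal part of \<open>[A, [A, f]] = 2 K f\<close>, obtained by pairing \<open>f\<close> with the indicator function
  of \<open>w\<close>: on average over the common neighbours of \<open>x\<close> and \<open>w\<close>, \<open>f\<close> is the mean of its values at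
  \<open>x\<close> and \<open>w\<close>.
\<close>

lemma sharp_midpoint:
  assumes cd: "CD_inf G K" and f: "f \<in> eigenspace G K" and x: "x \<in> V" and w: "w \<in> V" and ne: "x \<noteq> w"
  shows "(\<Sum>y\<in>N x \<inter> N w. f x + f w - 2 * f y) = 0"
proof -
  define g :: "'a \<Rightarrow> real" where "g z = (if z = w then 1 else 0)" for z
  have br: "2 * L f x - 2 * L f y - 2 * K * (f y - f x) = 0" if "y \<in> N x" for y
    using eigenspace_eq[OF f x] eigenspace_eq[OF f nbrs_in_verts[OF that]] by (simp add: algebra_simps)
  have "0 = cd_form K f g x"
    using cd_form_kernel[OF cd x sharp_eigenfunction(1)[OF cd f x]] by simp
  also have "\<dots> = (\<Sum>z\<in>V. (g z - g x) * (\<Sum>y\<in>N x \<inter> N z. f x + f z - 2 * f y))"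
    unfolding cd_form_eq[OF x] using br by simp
  also have "\<dots> = (\<Sum>z\<in>V. if z = w then (\<Sum>y\<in>N x \<inter> N w. f x + f w - 2 * f y) else 0)"
    by (intro sum.cong refl) (use ne in \<open>auto simp: g_def\<close>)
  also have "\<dots> = (\<Sum>y\<in>N x \<inter> N w. f x + f w - 2 * f y)"
    using finite_verts w by simp
  finally show ?thesis by simp
qed

lemma sum_nbrs_eigen:
  assumes f: "f \<in> eigenspace G l" and x: "x \<in> V"
  shows "(\<Sum>y\<in>N x. f y) = (real d - l) * f x"
  using laplacian_eq[OF x, of f] eigenspace_eq[OF f x] by (simp add: algebra_simps)

text \<open>
  The row of \<open>x\<close> in \<open>[A, [A, f]]\<close> has only its diagonal entry \<open>2 K f x\<close>, while summing the row over
  walks of length two gives \<open>K\<^sup>2 f x\<close>.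
\<close>

lemma sharp_eigenvalue:
  assumes cd: "CD_inf G K" and f: "f \<in> eigenspace G K" and x: "x \<in> V" and nz: "f x \<noteq> 0"
  shows "K = 0 \<or> K = 2"
proof -
  have "(\<Sum>w\<in>V. \<Sum>y\<in>N x \<inter> N w. f x + f w - 2 * f y) = (\<Sum>w\<in>V. if w = x then 2 * K * f x else 0)"
  proof (intro sum.cong refl)
    fix w assume w: "w \<in> V"
    show "(\<Sum>y\<in>N x \<inter> N w. f x + f w - 2 * f y) = (if w = x then 2 * K * f x else 0)"
    proof (cases "w = x")
      case True
      have "(\<Sum>y\<in>N x. f x + f x - 2 * f y) = real d * (2 * f x) - 2 * (\<Sum>y\<in>N x. f y)"
        using x by (simp add: sum_subtractf sum_distrib_left card_nbrs)
      then show ?thesis using True sum_nbrs_eigen[OF f x] by (simp add: algebra_simps)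
    next
      case False then show ?thesis using sharp_midpoint[OF cd f x w] by simp
    qed
  qed
  also have "\<dots> = 2 * K * f x" using finite_verts x by simp
  also have "(\<Sum>w\<in>V. \<Sum>y\<in>N x \<inter> N w. f x + f w - 2 * f y) = (\<Sum>y\<in>N x. \<Sum>w\<in>N y. f x + f w - 2 * f y)"
    by (rule two_step_sum[symmetric])
  also have "\<dots> = (\<Sum>y\<in>N x. real d * f x - (real d + K) * f y)"
  proof (intro sum.cong refl)
    fix y assume "y \<in> N x"
    then have y: "y \<in> V" by (rule nbrs_in_verts)
    show "(\<Sum>w\<in>N y. f x + f w - 2 * f y) = real d * f x - (real d + K) * f y"
      using sum_nbrs_eigen[OF f y] y by (simp add: sum_subtractf sum.distrib sum_distrib_left[symmetric] card_nbrs algebra_simps)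
  qed
  also have "\<dots> = real d * (real d * f x) - (real d + K) * ((real d - K) * f x)"
    using x by (simp add: sum_subtractf sum_distrib_left[symmetric] sum_nbrs_eigen[OF f x] card_nbrs)
  also have "\<dots> = K\<^sup>2 * f x" by (simp add: algebra_simps power2_eq_square)
  finally have "K\<^sup>2 * f x = 2 * K * f x" .
  then show ?thesis using nz by (simp add: power2_eq_square)
qed

lemma harmonic_imp_constant:
  assumes harm: "\<And>x. x \<in> V \<Longrightarrow> L h x = 0" and x: "x \<in> V" and y: "y \<in> V"
  shows "h x = h y"
proof -
  define M where "M = Max (h ` V)"
  have le: "h z \<le> M" if "z \<in> V" for z unfolding M_def using that finite_verts by simp
  define S where "S = {z \<in> V. h z = M}"
  have "M \<in> h ` V" unfolding M_def using finite_verts verts_nonempty by (intro Max_in) auto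
  then have ne: "S \<noteq> {}" by (auto simp: S_def)
  have "S = V"
  proof (rule closed_imp_all[OF _ ne])
    fix z assume z: "z \<in> S"
    then have zV: "z \<in> V" and hz: "h z = M" by (auto simp: S_def)
    have "(\<Sum>u\<in>N z. M - h u) = 0"
      using harm[OF zV] hz by (simp add: laplacian_nbrs sum_subtractf)
    then have "\<forall>u\<in>N z. M - h u = 0"
      using le nbrs_in_verts by (subst (asm) sum_nonneg_eq_0_iff) auto
    then show "N z \<subseteq> S" using nbrs_in_verts by (auto simp: S_def)
  qed (auto simp: S_def)
  then have "h z = M" if "z \<in> V" for z using that unfolding S_def by blast
  then show ?thesis using x y by simp
qed

end

locale cd2_graph = connected_regular_graph +
  assumes cd: "CD_inf G 2"
begin

abbreviation "E \<equiv> eigenspace G 2"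

text \<open>
  The identity \<open>[A, [A, f]] = 4 f\<close> in coordinates.  Its diagonal is the eigenvalue equation.
\<close>

lemma double_commutator:
  assumes f: "f \<in> E" and x: "x \<in> V" and w: "w \<in> V"
  shows "(\<Sum>y\<in>N x \<inter> N w. f x + f w - 2 * f y) = (if w = x then 4 * f x else 0)"
proof (cases "w = x")
  case True
  have "(\<Sum>y\<in>N x. f x + f x - 2 * f y) = real d * (2 * f x) - 2 * (\<Sum>y\<in>N x. f y)"
    using x by (simp add: sum_subtractf sum_distrib_left card_nbrs)
  then show ?thesis using True sum_nbrs_eigen[OF f x] by (simp add: algebra_simps)
next
  case False then show ?thesis using sharp_midpoint[OF cd f x w] by simp
qed

lemma sum_jumps: "f \<in> E \<Longrightarrow> x \<in> V \<Longrightarrow> (\<Sum>y\<in>N x. f y - f x) = - 2 * f x"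
  using eigenspace_eq[of f 2 x] by (simp add: laplacian_nbrs)

lemma sum_sq_jumps_const:
  assumes "f \<in> E" "x \<in> V" "y \<in> V"
  shows "(\<Sum>z\<in>N x. (f z - f x)\<^sup>2) = (\<Sum>z\<in>N y. (f z - f y)\<^sup>2)"
  using harmonic_imp_constant[OF sharp_eigenfunction(2)[OF cd assms(1)] assms(2,3)]
  by (simp add: Gamma_eq power2_eq_square)

text \<open>Since the energy \<open>\<Gamma>(f)\<close> is constant, it vanishes everywhere once it vanishes at one vertex.\<close>

lemma flat_imp_zero:
  assumes f: "f \<in> E" and x: "x \<in> V" and flat: "\<And>y. y \<in> N x \<Longrightarrow> f y = f x"
  shows "f z = 0"
proof (cases "z \<in> V")
  case False then show ?thesis using eigenspace_outside[OF f] by simp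
next
  case True
  have flat': "f u = f y" if "y \<in> V" "u \<in> N y" for y u
  proof -
    have "(\<Sum>z\<in>N y. (f z - f y)\<^sup>2) = 0"
      using sum_sq_jumps_const[OF f that(1) x] flat by simp
    then show ?thesis using that(2) by (simp add: sum_nonneg_eq_0_iff)
  qed
  have "L f z = 0" using flat'[OF True] by (simp add: laplacian_nbrs)
  then show ?thesis using eigenspace_eq[OF f True] by simp
qed

end

section \<open>Local minima of eigenfunctions\<close>

context cd2_graph begin

definition cubic_jumps :: "('a \<Rightarrow> real) \<Rightarrow> 'a \<Rightarrow> real" where
  "cubic_jumps f x = (if x \<in> V then \<Sum>y\<in>N x. (f y - f x) ^ 3 else 0)"

text \<open>
  Let \<open>k\<close> be the matrix of squared jumps on edges.  The entry of \<open>[A, k]\<close> at \<open>(x, z)\<close> is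
  \<open>(f z - f x)\<close> times a midpoint defect, so \<open>k\<close> commutes with \<open>A\<close> and maps \<open>E\<close> to itself.  The sum of
  cubed jumps is \<open>k f - c f\<close>, where \<open>c\<close> is the constant row sum of \<open>k\<close>.
\<close>

lemma cubic_jumps_in_E:
  assumes f: "f \<in> E"
  shows "cubic_jumps f \<in> E"
proof (rule eigenspaceI)
  show "cubic_jumps f x = 0" if "x \<notin> V" for x
    using that by (simp add: cubic_jumps_def)
next
  fix x assume x: "x \<in> V"
  define k where "k x y = (f y - f x)\<^sup>2" for x y
  define T where "T x = (\<Sum>y\<in>N x. k x y * f y)" for x
  define c where "c = (\<Sum>y\<in>N x. k x y)"
  have c: "(\<Sum>z\<in>N y. k y z) = c" if "y \<in> V" for y
    unfolding c_def k_def by (rule sum_sq_jumps_const[OF f that x])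
  have cub: "cubic_jumps f y = T y - c * f y" if y: "y \<in> V" for y
  proof -
    have "cubic_jumps f y = (\<Sum>z\<in>N y. k y z * f z - k y z * f y)"
      using y by (simp add: cubic_jumps_def k_def power3_eq_cube power2_eq_square algebra_simps)
    then show ?thesis by (simp add: sum_subtractf T_def c[OF y, symmetric] sum_distrib_right)
  qed
  have "(\<Sum>y\<in>N x. T y) = (\<Sum>z\<in>V. \<Sum>y\<in>N x \<inter> N z. k y z * f z)"
    unfolding T_def by (rule two_step_sum)
  also have "\<dots> = (\<Sum>z\<in>V. \<Sum>y\<in>N x \<inter> N z. k x y * f z)"
  proof (rule sum.cong[OF refl])
    fix z assume z: "z \<in> V"
    have "(\<Sum>y\<in>N x \<inter> N z. k y z * f z) - (\<Sum>y\<in>N x \<inter> N z. k x y * f z)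
        = (\<Sum>y\<in>N x \<inter> N z. f z * (f z - f x) * (f x + f z - 2 * f y))"
      unfolding sum_subtractf[symmetric]
      by (intro sum.cong refl) (simp add: k_def power2_eq_square algebra_simps)
    also have "\<dots> = f z * (f z - f x) * (\<Sum>y\<in>N x \<inter> N z. f x + f z - 2 * f y)"
      by (simp add: sum_distrib_left)
    also have "\<dots> = 0" using double_commutator[OF f x z] by simp
    finally show "(\<Sum>y\<in>N x \<inter> N z. k y z * f z) = (\<Sum>y\<in>N x \<inter> N z. k x y * f z)" by simp
  qed
  also have "\<dots> = (\<Sum>y\<in>N x. \<Sum>z\<in>N y. k x y * f z)"
    by (rule two_step_sum[symmetric])
  also have "\<dots> = (\<Sum>y\<in>N x. (real d - 2) * (k x y * f y))"
    by (intro sum.cong refl) (simp add: sum_distrib_left[symmetric] sum_nbrs_eigen[OF f nbrs_in_verts])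
  also have "\<dots> = (real d - 2) * T x"
    by (simp add: T_def sum_distrib_left)
  finally have T: "(\<Sum>y\<in>N x. T y) = (real d - 2) * T x" .
  have "(\<Sum>y\<in>N x. cubic_jumps f y) = (\<Sum>y\<in>N x. T y - c * f y)"
    by (intro sum.cong refl cub nbrs_in_verts)
  also have "\<dots> = (real d - 2) * T x - c * ((real d - 2) * f x)"
    by (simp add: sum_subtractf sum_distrib_left[symmetric] T sum_nbrs_eigen[OF f x])
  finally show "L (cubic_jumps f) x = - 2 * cubic_jumps f x"
    unfolding laplacian_eq[OF x] cub[OF x] by (simp add: algebra_simps)
qed

definition codeg :: "'a \<Rightarrow> 'a \<Rightarrow> real" where
  "codeg x z = real (card (N x \<inter> N z))"

lemma sum_common_const: "(\<Sum>y\<in>N x \<inter> N z. c) = codeg x z * c"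
  by (simp add: codeg_def)

lemma codeg_jump:
  assumes f: "f \<in> E" and x: "x \<in> V" and z: "z \<in> V" and ne: "z \<noteq> x"
  shows "(\<Sum>y\<in>N x \<inter> N z. f y - f x) = codeg x z * (f z - f x) / 2"
proof -
  have "0 = (\<Sum>y\<in>N x \<inter> N z. (f z - f x) - 2 * (f y - f x))"
    using double_commutator[OF f x z] ne by (simp add: algebra_simps)
  also have "\<dots> = codeg x z * (f z - f x) - 2 * (\<Sum>y\<in>N x \<inter> N z. f y - f x)"
    unfolding sum_subtractf[of "\<lambda>y. f z - f x"] sum_common_const sum_distrib_left ..
  finally show ?thesis by simp
qed

text \<open>
  Three ways of summing the double commutator around \<open>x\<close>: weighted by the number of common neighbours
  with \<open>x\<close>, over pairs of neighbours of \<open>x\<close>, and unweighted over walks of length two.  The combination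
  in the statement is the one in which all diagonal terms cancel.
\<close>

lemma codeg_moment:
  assumes f: "f \<in> E" and x: "x \<in> V"
  shows "(\<Sum>z\<in>V. codeg x z * (codeg x z - 2) * (f z - f x)) = 0"
proof -
  let ?p = "codeg x"
  define P where "P = (\<Sum>z\<in>V. (?p z)\<^sup>2 * f z)"
  define Q where "Q = (\<Sum>z\<in>V. (?p z)\<^sup>2 * f x)"
  define R where "R = (\<Sum>z\<in>V. ?p z * (\<Sum>u\<in>N x \<inter> N z. f u))"
  define S where "S = (\<Sum>z\<in>V. ?p z * (f z - f x))"
  have px: "?p x = d" using card_nbrs[OF x] by (simp add: codeg_def)
  have "Q + P - 2 * R = (\<Sum>z\<in>V. ?p z * (\<Sum>u\<in>N x \<inter> N z. f x + f z - 2 * f u))"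
    unfolding P_def Q_def R_def sum_distrib_left sum.distrib[symmetric] sum_subtractf[symmetric]
    by (intro sum.cong[OF refl], simp only: sum_subtractf sum_common_const sum_distrib_left[symmetric])
      (simp add: power2_eq_square algebra_simps)
  also have "\<dots> = (\<Sum>z\<in>V. if z = x then real d * (4 * f x) else 0)"
    by (intro sum.cong refl) (simp add: double_commutator[OF f x] px)
  also have "\<dots> = real d * (4 * f x)" using finite_verts x by simp
  finally have one: "Q + P - 2 * R = real d * (4 * f x)" .
  have "2 * R - 2 * P = (\<Sum>z\<in>V. \<Sum>y\<in>N x \<inter> N z. \<Sum>y'\<in>N x \<inter> N z. f y + f y' - 2 * f z)"
    unfolding P_def R_def sum_distrib_left sum_subtractf[symmetric]
    by (intro sum.cong[OF refl], simp only: sum_subtractf sum.distrib sum_common_const sum_distrib_left[symmetric])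
      (simp add: power2_eq_square algebra_simps)
  also have "\<dots> = (\<Sum>y\<in>N x. \<Sum>z\<in>N y. \<Sum>y'\<in>N x \<inter> N z. f y + f y' - 2 * f z)"
    by (rule two_step_sum[symmetric])
  also have "\<dots> = (\<Sum>y\<in>N x. \<Sum>y'\<in>N x. \<Sum>z\<in>N y \<inter> N y'. f y + f y' - 2 * f z)"
  proof (rule sum.cong[OF refl])
    fix y assume "y \<in> N x"
    have "(\<Sum>z\<in>N y. \<Sum>y'\<in>N x \<inter> N z. f y + f y' - 2 * f z)
        = (\<Sum>z\<in>N y. \<Sum>y' | y' \<in> N x \<and> z \<in> N y'. f y + f y' - 2 * f z)"
      by (intro sum.cong refl) (use nbrs_sym in auto)
    also have "\<dots> = (\<Sum>y'\<in>N x. \<Sum>z | z \<in> N y \<and> z \<in> N y'. f y + f y' - 2 * f z)"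
      by (rule sum.swap_restrict) auto
    also have "\<dots> = (\<Sum>y'\<in>N x. \<Sum>z\<in>N y \<inter> N y'. f y + f y' - 2 * f z)"
      by (intro sum.cong refl) auto
    finally show "(\<Sum>z\<in>N y. \<Sum>y'\<in>N x \<inter> N z. f y + f y' - 2 * f z) = \<dots>" .
  qed
  also have "\<dots> = (\<Sum>y\<in>N x. \<Sum>y'\<in>N x. if y' = y then 4 * f y else 0)"
    by (intro sum.cong refl double_commutator[OF f]) (use nbrs_in_verts in auto)
  also have "\<dots> = 4 * (\<Sum>y\<in>N x. f y)"
    by (simp add: sum_distrib_left)
  also have "\<dots> = 4 * ((real d - 2) * f x)" by (simp add: sum_nbrs_eigen[OF f x])
  finally have two: "2 * R - 2 * P = 4 * ((real d - 2) * f x)" .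
  have "S = (\<Sum>z\<in>V. \<Sum>y\<in>N x \<inter> N z. f z - f x)"
    unfolding S_def sum_common_const ..
  also have "\<dots> = (\<Sum>y\<in>N x. \<Sum>z\<in>N y. f z - f x)"
    by (rule two_step_sum[symmetric])
  also have "\<dots> = (\<Sum>y\<in>N x. (real d - 2) * f y - real d * f x)"
    by (intro sum.cong refl)
      (simp add: sum_subtractf sum_nbrs_eigen[OF f nbrs_in_verts] card_nbrs[OF nbrs_in_verts])
  also have "\<dots> = (real d - 2) * ((real d - 2) * f x) - real d * (real d * f x)"
    by (simp add: sum_subtractf sum_distrib_left[symmetric] sum_nbrs_eigen[OF f x] card_nbrs[OF x])
  finally have three: "S = (4 - 4 * real d) * f x" by (simp add: algebra_simps)
  have "(\<Sum>z\<in>V. ?p z * (?p z - 2) * (f z - f x)) = P - Q - 2 * S"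
    unfolding P_def Q_def S_def sum_distrib_left sum_subtractf[symmetric]
    by (intro sum.cong refl) (simp add: power2_eq_square algebra_simps)
  also have "\<dots> = 0" using one two three by (simp add: algebra_simps)
  finally show ?thesis .
qed

text \<open>
  For an edge \<open>x w\<close> in no triangle, this is the indicator function of \<open>w\<close> on the ball of radius one
  around \<open>x\<close>, continued to distance two by the values that minimise the curvature form at \<open>x\<close>: twice
  the mean over the common neighbours with \<open>x\<close>.
\<close>

definition spike :: "'a \<Rightarrow> 'a \<Rightarrow> 'a \<Rightarrow> real" where
  "spike x w v = (if v = w then 1 else if v \<in> N w - {x} then 2 / codeg x v else 0)"

context
  fixes x w
  assumes x: "x \<in> V" and w: "w \<in> N x" and no_triangle: "N x \<inter> N w = {}"
begin

lemma spike_center: "spike x w x = 0"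
  using w nbrs_irrefl by (auto simp: spike_def)

lemma spike_nbr: "y \<in> N x \<Longrightarrow> y \<noteq> w \<Longrightarrow> spike x w y = 0"
  using no_triangle by (auto simp: spike_def)

lemma laplacian_spike_center: "L (spike x w) x = 1"
proof -
  have "L (spike x w) x = (\<Sum>y\<in>N x. if y = w then 1 else 0)"
    unfolding laplacian_nbrs spike_center
    by (intro sum.cong refl) (use spike_nbr in \<open>auto simp: spike_def[of x w w]\<close>)
  then show ?thesis using w by simp
qed

lemma cd_form_spike: "cd_form 2 (spike x w) (spike x w) x = (\<Sum>z\<in>N w - {x}. 2 - 4 / codeg x z)"
proof -
  have "(spike x w z - spike x w x) * (\<Sum>y\<in>N x \<inter> N z. spike x w x + spike x w z - 2 * spike x w y) = 0"
    if z: "z \<in> V" for z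
  proof (cases "z \<in> N w - {x}")
    case False
    then have "z = w \<or> spike x w z = 0" by (auto simp: spike_def)
    then consider "z = w" | "spike x w z = 0" by blast
    then show ?thesis using no_triangle by cases (auto simp: spike_center)
  next
    case True
    then have zw: "z \<noteq> w" using nbrs_irrefl by auto
    have wz: "w \<in> N x \<inter> N z" using True w nbrs_sym by auto
    then have pos: "codeg x z \<noteq> 0" by (auto simp: codeg_def)
    have "(\<Sum>y\<in>N x \<inter> N z. spike x w x + spike x w z - 2 * spike x w y)
        = (\<Sum>y\<in>N x \<inter> N z. spike x w z - (if y = w then 2 else 0))"
      by (intro sum.cong refl) (use spike_nbr in \<open>auto simp: spike_center spike_def[of x w w]\<close>)
    also have "\<dots> = codeg x z * spike x w z - 2"
      using wz by (simp add: sum_subtractf codeg_def)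
    also have "\<dots> = 0" using True zw pos by (simp add: spike_def)
    finally show ?thesis by simp
  qed
  then have "cd_form 2 (spike x w) (spike x w) x
      = (\<Sum>y\<in>N x. (spike x w y - spike x w x)
           * (2 * L (spike x w) x - 2 * L (spike x w) y - 2 * 2 * (spike x w y - spike x w x)))"
    unfolding cd_form_eq[OF x] using sum.neutral[OF ballI] by (metis (mono_tags, lifting) add_0)
  also have "\<dots> = (\<Sum>y\<in>N x. if y = w then - 2 - 2 * L (spike x w) w else 0)"
    by (intro sum.cong refl)
      (use spike_nbr in \<open>auto simp: spike_center laplacian_spike_center spike_def[of x w w]\<close>)
  also have "\<dots> = - 2 - 2 * L (spike x w) w" using w by simp
  also have "L (spike x w) w = -1 + (\<Sum>z\<in>N w - {x}. 2 / codeg x z - 1)"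
  proof -
    have "L (spike x w) w = (\<Sum>z\<in>N w. spike x w z - 1)"
      by (simp add: laplacian_nbrs spike_def)
    also have "\<dots> = -1 + (\<Sum>z\<in>N w - {x}. spike x w z - 1)"
      using w nbrs_sym by (subst sum.remove[of _ x]) (auto simp: spike_center)
    also have "(\<Sum>z\<in>N w - {x}. spike x w z - 1) = (\<Sum>z\<in>N w - {x}. 2 / codeg x z - 1)"
      by (intro sum.cong refl) (use nbrs_irrefl in \<open>auto simp: spike_def\<close>)
    finally show ?thesis .
  qed
  also have "- 2 - 2 * (-1 + (\<Sum>z\<in>N w - {x}. 2 / codeg x z - 1)) = (\<Sum>z\<in>N w - {x}. - 2 * (2 / codeg x z - 1))"
    unfolding sum_distrib_left[symmetric] by simp
  also have "\<dots> = (\<Sum>z\<in>N w - {x}. 2 - 4 / codeg x z)"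
    by (intro sum.cong refl) simp
  finally show ?thesis .
qed

text \<open>
  The curvature form is nonnegative at the spike.  In other words, the numbers of common neighbours of
  \<open>x\<close> with the vertices reached through \<open>w\<close> have harmonic mean at least two.
\<close>

lemma codeg_bound: "0 \<le> (\<Sum>z\<in>N w - {x}. 2 - 4 / codeg x z)"
  using cd_form_nonneg[OF cd x, of "spike x w"] by (simp add: cd_form_spike)

text \<open>
  In the case of equality the spike lies in the radical of the curvature form; pairing it with the
  indicator function of \<open>y\<close> counts the squares through \<open>x w\<close> and \<open>x y\<close>.
\<close>

lemma unique_square:
  assumes two: "\<And>z. z \<in> N w - {x} \<Longrightarrow> codeg x z = 2" and y: "y \<in> N x" and yw: "y \<noteq> w"
  shows "card (N w \<inter> N y) = 2"
proof -
  let ?g = "spike x w"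
  define e :: "'a \<Rightarrow> real" where "e v = (if v = y then 1 else 0)" for v
  have ex: "e x = 0" using y nbrs_irrefl by (auto simp: e_def)
  have wy: "w \<notin> N y" "y \<notin> N w" using no_triangle y nbrs_sym by auto
  have "cd_form 2 ?g ?g x = 0" unfolding cd_form_spike using two by simp
  then have "0 = cd_form 2 ?g e x" using cd_form_kernel[OF cd x] by simp
  also have "\<dots> = (\<Sum>z\<in>V. if z = y then (\<Sum>u\<in>N x \<inter> N y. ?g x + ?g y - 2 * ?g u) else 0)
      + (\<Sum>z\<in>N x. if z = y then 2 * L ?g x - 2 * L ?g y - 2 * 2 * (?g y - ?g x) else 0)"
    unfolding cd_form_eq[OF x] ex
    by (intro arg_cong2[of _ _ _ _ "(+)"] sum.cong[OF refl]) (auto simp: e_def)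
  also have "\<dots> = (\<Sum>u\<in>N x \<inter> N y. ?g x + ?g y - 2 * ?g u) + (2 * L ?g x - 2 * L ?g y - 2 * 2 * (?g y - ?g x))"
    using y nbrs_in_verts finite_verts by simp
  also have "\<dots> = 2 - 2 * L ?g y"
  proof -
    have "(\<Sum>u\<in>N x \<inter> N y. ?g x + ?g y - 2 * ?g u) = 0"
      by (rule sum.neutral) (use wy spike_nbr y yw in \<open>auto simp: spike_center\<close>)
    then show ?thesis by (simp add: spike_center spike_nbr[OF y yw] laplacian_spike_center)
  qed
  also have "L ?g y = (\<Sum>v\<in>N y. if v \<in> N w - {x} then 1 else 0)"
    unfolding laplacian_nbrs spike_nbr[OF y yw]
    by (intro sum.cong refl) (use wy two in \<open>auto simp: spike_def\<close>)
  also have "\<dots> = real (card (N y \<inter> (N w - {x})))"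
    by (simp add: sum.If_cases set_diff_eq Int_def)
  finally have "card (N y \<inter> (N w - {x})) = 1" by simp
  moreover have "N w \<inter> N y = insert x (N y \<inter> (N w - {x}))" using y w nbrs_sym by auto
  ultimately show ?thesis by simp
qed

end

text \<open>
  Summing the double commutator over the neighbours of \<open>x\<close> gives \<open>\<Sum> t\<^sub>u (f u - f x) = 0\<close>, where
  \<open>t\<^sub>u\<close> is the number of triangles on the edge \<open>x u\<close>.  At a local minimum no term is negative.
\<close>

lemma local_min_no_triangle:
  assumes f: "f \<in> E" and x: "x \<in> V" and ge: "\<And>y. y \<in> N x \<Longrightarrow> f x \<le> f y"
    and w: "w \<in> N x" and gt: "f x < f w"
  shows "N x \<inter> N w = {}"
proof -
  have swap: "(\<Sum>u\<in>N x. \<Sum>y\<in>N x \<inter> N u. f y) = (\<Sum>u\<in>N x. \<Sum>y\<in>N x \<inter> N u. f u)"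
  proof -
    have "(\<Sum>u\<in>N x. \<Sum>y\<in>N x \<inter> N u. f y) = (\<Sum>u\<in>N x. \<Sum>y | y \<in> N x \<and> y \<in> N u. f y)"
      by (intro sum.cong refl) auto
    also have "\<dots> = (\<Sum>y\<in>N x. \<Sum>u | u \<in> N x \<and> y \<in> N u. f y)"
      by (rule sum.swap_restrict) auto
    also have "\<dots> = (\<Sum>y\<in>N x. \<Sum>u\<in>N x \<inter> N y. f y)"
      by (intro sum.cong refl) (use nbrs_sym in auto)
    finally show ?thesis .
  qed
  have "0 = (\<Sum>u\<in>N x. \<Sum>y\<in>N x \<inter> N u. f x + f u - 2 * f y)"
    using double_commutator[OF f x nbrs_in_verts] nbrs_irrefl by (intro sum.neutral[symmetric] ballI) auto
  also have "\<dots> = (\<Sum>u\<in>N x. codeg x u * (f x - f u))"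
  proof -
    have "(\<Sum>u\<in>N x. \<Sum>y\<in>N x \<inter> N u. f x + f u - 2 * f y)
        = (\<Sum>u\<in>N x. \<Sum>y\<in>N x \<inter> N u. f x + f u) - 2 * (\<Sum>u\<in>N x. \<Sum>y\<in>N x \<inter> N u. f y)"
      by (simp only: sum_subtractf sum_distrib_left)
    also have "\<dots> = (\<Sum>u\<in>N x. \<Sum>y\<in>N x \<inter> N u. f x - f u)"
      unfolding swap unfolding sum_distrib_left sum_subtractf[symmetric] by (intro sum.cong refl) simp
    finally show ?thesis by (simp only: sum_common_const)
  qed
  finally have "(\<Sum>u\<in>N x. codeg x u * (f u - f x)) = 0"
    by (simp add: right_diff_distrib sum_subtractf)
  moreover have "\<forall>u\<in>N x. 0 \<le> codeg x u * (f u - f x)"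
    using ge by (simp add: codeg_def)
  ultimately have "codeg x w * (f w - f x) = 0"
    using w by (simp add: sum_nonneg_eq_0_iff)
  then show ?thesis using gt by (simp add: codeg_def)
qed

text \<open>
  Write \<open>p\<^sub>z\<close> for the number of common neighbours of \<open>x\<close> and \<open>z\<close>.  Weighting the bounds
  \<open>codeg_bound\<close> with the jumps \<open>f u - f x \<ge> 0\<close> yields \<open>\<Sum> (p\<^sub>z - 2) (f z - f x) \<ge> 0\<close> over the \<open>z\<close>
  with \<open>p\<^sub>z > 0\<close>, while \<open>codeg_moment\<close> says \<open>\<Sum> p\<^sub>z (p\<^sub>z - 2) (f z - f x) = 0\<close>.  Subtracting twice the
  former, \<open>\<Sum> (p\<^sub>z - 2)\<^sup>2 (f z - f x) \<le> 0\<close>, and here no term is negative.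
\<close>

lemma local_min_codeg:
  assumes f: "f \<in> E" and x: "x \<in> V" and ge: "\<And>y. y \<in> N x \<Longrightarrow> f x \<le> f y"
    and w: "w \<in> N x" and gt: "f x < f w" and z: "z \<in> N w - {x}"
  shows "codeg x z = 2"
proof -
  let ?p = "codeg x"
  \<comment> \<open>Equal to \<open>(p\<^sub>z - 2)\<^sup>2 (f z - f x)\<close> if \<open>p\<^sub>z\<close> is positive, and to zero if \<open>p\<^sub>z = 0\<close>.\<close>
  define t where "t z = ?p z * (?p z - 2) * (f z - f x) - 2 * ((2 - 4 / ?p z) * (?p z * (f z - f x) / 2))" for z
  have jump: "0 \<le> ?p z * (f z - f x)" if "z \<in> V" "z \<noteq> x" for z
    using codeg_jump[OF f x that] sum_nonneg[of "N x \<inter> N z" "\<lambda>y. f y - f x"] ge by simp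
  have t_eq: "t z = (?p z - 2)\<^sup>2 * (f z - f x)" if "?p z \<noteq> 0" for z
    using that by (simp add: t_def field_simps power2_eq_square)
  have t_nonneg: "0 \<le> t z" if "z \<in> V - {x}" for z
  proof (cases "?p z = 0")
    case True then show ?thesis by (simp add: t_def)
  next
    case False
    then have "0 < ?p z" by (simp add: codeg_def card_gt_0_iff)
    then have "0 \<le> f z - f x" using jump[of z] that by (simp add: zero_le_mult_iff)
    then show ?thesis using t_eq[OF False] by simp
  qed
  have "0 \<le> (\<Sum>u\<in>N x. (f u - f x) * (\<Sum>z\<in>N u - {x}. 2 - 4 / ?p z))"
  proof (rule sum_nonneg)
    fix u assume u: "u \<in> N x"
    show "0 \<le> (f u - f x) * (\<Sum>z\<in>N u - {x}. 2 - 4 / ?p z)"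
    proof (cases "f x < f u")
      case True
      then show ?thesis
        using codeg_bound[OF x u local_min_no_triangle[OF f x ge u True]] by simp
    next
      case False then show ?thesis using ge[OF u] by simp
    qed
  qed
  also have "\<dots> = (\<Sum>u\<in>N x. \<Sum>z\<in>N u. if z = x then 0 else (f u - f x) * (2 - 4 / ?p z))"
  proof (rule sum.cong[OF refl])
    fix u assume u: "u \<in> N x"
    show "(f u - f x) * (\<Sum>z\<in>N u - {x}. 2 - 4 / ?p z) = (\<Sum>z\<in>N u. if z = x then 0 else (f u - f x) * (2 - 4 / ?p z))"
      using nbrs_sym[OF u] by (subst sum.remove[of "N u" x]) (auto simp: sum_distrib_left intro!: sum.cong)
  qed
  also have "\<dots> = (\<Sum>z\<in>V. \<Sum>u\<in>N x \<inter> N z. if z = x then 0 else (f u - f x) * (2 - 4 / ?p z))"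
    by (rule two_step_sum)
  also have "\<dots> = (\<Sum>z\<in>V - {x}. (2 - 4 / ?p z) * (?p z * (f z - f x) / 2))"
    using x finite_verts
    by (subst sum.remove[of V x])
      (auto simp: sum_distrib_right[symmetric] codeg_jump[OF f x] mult.commute intro!: sum.cong)
  finally have bound: "0 \<le> (\<Sum>z\<in>V - {x}. (2 - 4 / ?p z) * (?p z * (f z - f x) / 2))" .
  have moment: "(\<Sum>z\<in>V - {x}. ?p z * (?p z - 2) * (f z - f x)) = 0"
    using codeg_moment[OF f x] x finite_verts by (subst (asm) sum.remove[of V x]) auto
  have "(\<Sum>z\<in>V - {x}. t z) \<le> 0"
    unfolding t_def sum_subtractf moment sum_distrib_left[symmetric] using bound by simp
  then have "(\<Sum>z\<in>V - {x}. t z) = 0"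
    using sum_nonneg[of "V - {x}" t] t_nonneg by fastforce
  then have "\<forall>z\<in>V - {x}. t z = 0"
    using t_nonneg finite_verts by (subst (asm) sum_nonneg_eq_0_iff) auto
  moreover have zV: "z \<in> V - {x}" using z nbrs_in_verts by auto
  ultimately have tz: "t z = 0" by blast
  have wz: "w \<in> N x \<inter> N z" using w z nbrs_sym by auto
  then have pz: "?p z \<noteq> 0" by (auto simp: codeg_def)
  have "f w - f x \<le> (\<Sum>y\<in>N x \<inter> N z. f y - f x)"
    by (rule member_le_sum[OF wz]) (use ge in auto)
  then have "0 < ?p z * (f z - f x)" using gt codeg_jump[OF f x, of z] zV by simp
  then have "f z - f x \<noteq> 0" by auto
  then show ?thesis using tz t_eq[OF pz] by simp
qed

end

section \<open>Blocks of neighbours\<close>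

interpretation fun_vs: vector_space fun_scale
  by (rule vector_space_fun_scale)

interpretation fun_vs_pair: vector_space_pair fun_scale fun_scale
  by unfold_locales

lemma sum_fun_apply: "(\<Sum>i\<in>I. F i) y = (\<Sum>i\<in>I. F i y)"
  by (induction I rule: infinite_finite_induct) auto

definition point_mass :: "'a \<Rightarrow> 'a \<Rightarrow> real" where
  "point_mass r = (\<lambda>y. if y = r then 1 else 0)"

lemma supported_in_span:
  assumes fin: "finite R" and supp: "\<And>y. y \<notin> R \<Longrightarrow> h y = 0"
  shows "h \<in> fun_vs.span (point_mass ` R)"
proof -
  have "h = (\<Sum>r\<in>R. fun_scale (h r) (point_mass r))"
  proof
    fix y
    have "(\<Sum>r\<in>R. fun_scale (h r) (point_mass r)) y = (\<Sum>r\<in>R. if y = r then h r else 0)"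
      unfolding sum_fun_apply by (intro sum.cong refl) (auto simp: fun_scale_def point_mass_def)
    also have "\<dots> = h y" using fin supp by simp
    finally show "h y = (\<Sum>r\<in>R. fun_scale (h r) (point_mass r)) y" by simp
  qed
  also have "\<dots> \<in> fun_vs.span (point_mass ` R)"
    by (intro fun_vs.span_sum fun_vs.span_scale fun_vs.span_base) auto
  finally show ?thesis .
qed

text \<open>
  The functionals are indexed by points of the domain, so that the induced injective map goes into
  the functions supported on \<open>R\<close>.
\<close>

lemma dim_le_card_functionals:
  fixes W :: "('a \<Rightarrow> real) set" and \<phi> :: "'a \<Rightarrow> ('a \<Rightarrow> real) \<Rightarrow> real"
  assumes sub: "fun_vs.subspace W" and fin: "finite R"
    and add: "\<And>r f g. \<phi> r (f + g) = \<phi> r f + \<phi> r g"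
    and scale: "\<And>r c f. \<phi> r (fun_scale c f) = c * \<phi> r f"
    and inj: "\<And>f. f \<in> W \<Longrightarrow> (\<And>r. r \<in> R \<Longrightarrow> \<phi> r f = 0) \<Longrightarrow> f = 0"
  shows "fun_vs.dim W \<le> card R"
proof -
  define \<Phi> where "\<Phi> f = (\<lambda>r. if r \<in> R then \<phi> r f else 0)" for f
  have lin: "Vector_Spaces.linear fun_scale fun_scale \<Phi>"
    unfolding Vector_Spaces.linear_iff using vector_space_fun_scale
    by (auto simp: \<Phi>_def fun_eq_iff add scale) (auto simp: fun_scale_def scale[unfolded fun_scale_def])
  obtain B where B: "B \<subseteq> W" "fun_vs.independent B" "W \<subseteq> fun_vs.span B" "card B = fun_vs.dim W"
    by (rule fun_vs.basis_exists)
  have span: "fun_vs.span B \<subseteq> W" using fun_vs.span_minimal[OF B(1) sub] .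
  have inj_on: "inj_on \<Phi> (fun_vs.span B)"
  proof (rule inj_onI)
    fix f g assume fg: "f \<in> fun_vs.span B" "g \<in> fun_vs.span B" and eq: "\<Phi> f = \<Phi> g"
    have "f - g \<in> W" using span fg fun_vs.span_diff by blast
    moreover have "\<phi> r (f - g) = 0" if "r \<in> R" for r
    proof -
      have "\<phi> r f = \<phi> r g" using fun_cong[OF eq, of r] that by (simp add: \<Phi>_def)
      moreover have "\<phi> r f = \<phi> r (f - g) + \<phi> r g" using add[of r "f - g" g] by simp
      ultimately show ?thesis by simp
    qed
    ultimately have "f - g = 0" by (rule inj)
    then show "f = g" by simp
  qed
  have ind: "fun_vs.independent (\<Phi> ` B)"
    by (rule fun_vs_pair.linear_independent_injective_image[OF lin B(2) inj_on])
  have "\<Phi> ` B \<subseteq> fun_vs.span (point_mass ` R)"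
    by (auto simp: \<Phi>_def intro!: supported_in_span[OF fin])
  from fun_vs.independent_span_bound[OF _ ind this] fin
  have "card (\<Phi> ` B) \<le> card (point_mass ` R)" by simp
  also have "\<dots> \<le> card R" by (rule card_image_le[OF fin])
  also have "card (\<Phi> ` B) = card B"
    by (rule card_image) (rule inj_on_subset[OF inj_on fun_vs.span_superset])
  finally show ?thesis using B(4) by simp
qed

text \<open>
  Polarising the cube, the space \<open>S\<close> is closed under products of three functions.  Hence
  \<open>b \<mapsto> (f s - c f\<^sup>2) b\<close> maps \<open>S\<close> to itself for all \<open>s \<in> S\<close> and all constants \<open>c\<close>, and such maps can kill the
  value at any point that some function in \<open>S\<close> distinguishes from \<open>w\<close>, without killing the value
  at \<open>w\<close>.
\<close>

lemma cube_closed_indicator: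
  fixes S :: "('b \<Rightarrow> real) set"
  assumes fin: "finite U"
    and add: "\<And>s t. s \<in> S \<Longrightarrow> t \<in> S \<Longrightarrow> (\<lambda>y. s y + t y) \<in> S"
    and scale: "\<And>s c. s \<in> S \<Longrightarrow> (\<lambda>y. c * s y) \<in> S"
    and cube: "\<And>s. s \<in> S \<Longrightarrow> (\<lambda>y. s y ^ 3) \<in> S"
    and f: "f \<in> S" and pos: "\<And>y. y \<in> U \<Longrightarrow> 0 < f y" and w: "w \<in> U"
  shows "\<exists>s\<in>S. \<forall>y\<in>U. s y = (if \<forall>t\<in>S. t y = t w then 1 else 0)"
proof -
  have sq: "(\<lambda>y. a y * a y * b y) \<in> S" if a: "a \<in> S" and b: "b \<in> S" for a b
  proof -
    have "(\<lambda>y. (1/6) * (((a y + b y) ^ 3 + (-1) * (a y + (-1) * b y) ^ 3) + (-2) * b y ^ 3)) \<in> S"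
      by (intro add scale cube a b)
    also have "(\<lambda>y. (1/6) * (((a y + b y) ^ 3 + (-1) * (a y + (-1) * b y) ^ 3) + (-2) * b y ^ 3))
        = (\<lambda>y. a y * a y * b y)"
      by (simp add: fun_eq_iff power3_eq_cube algebra_simps)
    finally show ?thesis .
  qed
  have triple: "(\<lambda>y. a y * b y * c y) \<in> S" if a: "a \<in> S" and b: "b \<in> S" and c: "c \<in> S" for a b c
  proof -
    have "(\<lambda>y. (1/4) * ((a y + b y) * (a y + b y) * c y
        + (-1) * ((a y + (-1) * b y) * (a y + (-1) * b y) * c y))) \<in> S"
      by (intro scale add sq[of "\<lambda>y. a y + b y"] sq[of "\<lambda>y. a y + (-1) * b y"] a b c)
    also have "(\<lambda>y. (1/4) * ((a y + b y) * (a y + b y) * c y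
        + (-1) * ((a y + (-1) * b y) * (a y + (-1) * b y) * c y))) = (\<lambda>y. a y * b y * c y)"
      by (simp add: fun_eq_iff algebra_simps)
    finally show ?thesis .
  qed
  define T where "T = {y \<in> U. \<forall>t\<in>S. t y = t w}"
  have "\<exists>b\<in>S. b w \<noteq> 0 \<and> (\<forall>y\<in>A. b y = 0)" if "A \<subseteq> U - T" for A
    using finite_subset[OF that finite_Diff[OF fin]] that
  proof (induction A rule: finite_induct)
    case empty
    then show ?case using f pos[OF w] by (intro bexI[of _ f]) auto
  next
    case (insert y A)
    then obtain b where b: "b \<in> S" "b w \<noteq> 0" "\<And>z. z \<in> A \<Longrightarrow> b z = 0" by auto
    have y: "y \<in> U" "y \<notin> T" using insert.prems by auto
    have fy: "0 < f y" and fw: "0 < f w" using pos y w by auto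
    \<comment> \<open>If all quotients by \<open>f\<close> agreed at \<open>y\<close> and \<open>w\<close>, so would \<open>f ^ 3 / f\<close>; then \<open>f\<close> itself
      agrees there by positivity, and with it every function in \<open>S\<close>.\<close>
    have "\<exists>s\<in>S. s w * f y \<noteq> s y * f w"
    proof (rule ccontr)
      assume "\<not> ?thesis"
      then have all: "s w * f y = s y * f w" if "s \<in> S" for s using that by auto
      have "f w ^ 3 * f y = f y ^ 3 * f w" using all[OF cube[OF f]] .
      then have "(f w)\<^sup>2 * (f w * f y) = (f y)\<^sup>2 * (f w * f y)"
        by (simp add: power3_eq_cube power2_eq_square algebra_simps)
      then have "(f w)\<^sup>2 = (f y)\<^sup>2" using fy fw by simp
      then have "f w = f y" using fy fw by (simp add: power2_eq_iff)
      then have "t y = t w" if "t \<in> S" for t using all[OF that] fw by simp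
      then show False using y by (simp add: T_def)
    qed
    then obtain s where s: "s \<in> S" "s w * f y \<noteq> s y * f w" by auto
    define b' where "b' = (\<lambda>z. f z * s z * b z + (- (s y / f y)) * (f z * f z * b z))"
    have "b' \<in> S" unfolding b'_def by (intro add scale triple f s b)
    moreover have "b' w \<noteq> 0"
    proof -
      have "b' w = f w * b w * (s w * f y - s y * f w) / f y"
        using fy by (simp add: b'_def field_simps)
      then show ?thesis using s(2) b(2) fw fy by simp
    qed
    moreover have "b' z = 0" if "z \<in> insert y A" for z
      using that b(3) fy by (auto simp: b'_def)
    ultimately show ?case by blast
  qed
  from this[OF subset_refl] obtain b where b: "b \<in> S" "b w \<noteq> 0" "\<And>y. y \<in> U - T \<Longrightarrow> b y = 0" by blast
  have "(\<lambda>y. (1 / b w) * b y) \<in> S" by (rule scale[OF b(1)])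
  moreover have "(1 / b w) * b y = (if \<forall>t\<in>S. t y = t w then 1 else 0)" if "y \<in> U" for y
    using b that by (auto simp: T_def)
  ultimately show ?thesis by (intro bexI[of _ "\<lambda>y. (1 / b w) * b y"]) auto
qed

context connected_regular_graph begin

lemma eigenspace_subspace: "fun_vs.subspace (eigenspace G l)"
  using eigenspace_add eigenspace_scale
  by (intro fun_vs.subspaceI)
    (auto simp: fun_scale_def plus_fun_def zero_fun_def intro!: eigenspaceI simp: laplacian_nbrs)

lemma finite_eigenbasis:
  obtains A where "A \<subseteq> eigenspace G l" "fun_vs.independent A" "eigenspace G l \<subseteq> fun_vs.span A"
    "card A = eigen_mult G l" "finite A"
proof -
  obtain A where A: "A \<subseteq> eigenspace G l" "fun_vs.independent A" "eigenspace G l \<subseteq> fun_vs.span A"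
    "card A = fun_vs.dim (eigenspace G l)"
    by (rule fun_vs.basis_exists)
  have "A \<subseteq> fun_vs.span (point_mass ` V)"
    using A(1) eigenspace_outside by (auto intro!: supported_in_span finite_verts)
  then have "finite A"
    using fun_vs.independent_span_bound[OF _ A(2), of "point_mass ` V"] finite_verts by auto
  then show ?thesis using that A by (simp add: eigen_mult_def)
qed

end

context cd2_graph begin

text \<open>The fourth vertex of the square spanned by the edges from \<open>x\<close> to \<open>w\<close> and \<open>y\<close>.\<close>

definition opposite :: "'a \<Rightarrow> 'a \<Rightarrow> 'a \<Rightarrow> 'a" where
  "opposite x w y = (THE z. z \<in> N w \<inter> N y \<and> z \<noteq> x)"

context
  fixes f x w
  assumes f: "f \<in> E" and x: "x \<in> V" and ge: "\<And>y. y \<in> N x \<Longrightarrow> f x \<le> f y"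
    and w: "w \<in> N x" and gt: "f x < f w"
begin

lemma opposite_props:
  assumes y: "y \<in> N x - {w}"
  shows "opposite x w y \<in> N w - {x}" "opposite x w y \<in> N y"
    "\<And>z. z \<in> N w \<Longrightarrow> z \<in> N y \<Longrightarrow> z \<noteq> x \<Longrightarrow> z = opposite x w y"
proof -
  have "card (N w \<inter> N y) = 2"
    using unique_square[OF x w local_min_no_triangle[OF f x ge w gt] local_min_codeg[OF f x ge w gt]] y
    by auto
  moreover have "x \<in> N w \<inter> N y" using w y nbrs_sym by auto
  ultimately have "card (N w \<inter> N y - {x}) = 1" by simp
  then obtain z where z: "N w \<inter> N y - {x} = {z}" by (auto simp: card_1_singleton_iff)
  then have "opposite x w y = z" unfolding opposite_def by (intro the_equality) auto
  then show "opposite x w y \<in> N w - {x}" "opposite x w y \<in> N y"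
    "\<And>z. z \<in> N w \<Longrightarrow> z \<in> N y \<Longrightarrow> z \<noteq> x \<Longrightarrow> z = opposite x w y"
    using z by auto
qed

lemma opposite_common:
  assumes y: "y \<in> N x - {w}"
  shows "N x \<inter> N (opposite x w y) = {w, y}"
proof -
  let ?z = "opposite x w y"
  have "card (N x \<inter> N ?z) = 2"
    using local_min_codeg[OF f x ge w gt opposite_props(1)[OF y]] by (simp add: codeg_def)
  moreover have "{w, y} \<subseteq> N x \<inter> N ?z" using opposite_props[OF y] w y nbrs_sym by auto
  moreover have "card {w, y} = 2" using y by auto
  ultimately show ?thesis by (metis card_subset_eq finite_Int finite_nbrs)
qed

text \<open>
  The midpoint rule for \<open>x\<close> and the opposite vertex, whose only common neighbours are \<open>w\<close> and \<open>y\<close>.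
\<close>

lemma opposite_jump:
  assumes y: "y \<in> N x - {w}" and g: "g \<in> E"
  shows "g (opposite x w y) - g w = g y - g x"
proof -
  let ?z = "opposite x w y"
  have "?z \<in> V" "?z \<noteq> x" using opposite_props[OF y] nbrs_in_verts by auto
  then have "(\<Sum>u\<in>{w, y}. g x + g ?z - 2 * g u) = 0"
    using double_commutator[OF g x, of ?z] opposite_common[OF y] by simp
  then show ?thesis using y by auto
qed

lemma opposite_bij: "bij_betw (opposite x w) (N x - {w}) (N w - {x})"
proof (rule bij_betwI')
  fix y y' assume y: "y \<in> N x - {w}" and y': "y' \<in> N x - {w}"
  show "(opposite x w y = opposite x w y') = (y = y')"
  proof
    assume "opposite x w y = opposite x w y'"
    then have "{w, y} = {w, y'}" using opposite_common[OF y] opposite_common[OF y'] by metis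
    then have "y \<in> {w, y'}" by blast
    then show "y = y'" using y by blast
  qed simp
next
  fix y assume "y \<in> N x - {w}"
  then show "opposite x w y \<in> N w - {x}" by (rule opposite_props)
next
  fix z assume z: "z \<in> N w - {x}"
  then have "card (N x \<inter> N z) = 2"
    using local_min_codeg[OF f x ge w gt z] by (simp add: codeg_def)
  moreover have "w \<in> N x \<inter> N z" using w z nbrs_sym by auto
  ultimately have "card (N x \<inter> N z - {w}) = 1" by simp
  then obtain y where y: "N x \<inter> N z - {w} = {y}" by (auto simp: card_1_singleton_iff)
  then have "y \<in> N x - {w}" "z \<in> N y" using nbrs_sym by auto
  then show "\<exists>y\<in>N x - {w}. z = opposite x w y" using opposite_props(3)[of y z] z by auto
qed

lemma sum_nbrs_opposite:
  fixes \<phi> :: "'a \<Rightarrow> real"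
  shows "(\<Sum>z\<in>N w. \<phi> z) = \<phi> x + (\<Sum>y\<in>N x - {w}. \<phi> (opposite x w y))"
proof -
  have "(\<Sum>z\<in>N w. \<phi> z) = \<phi> x + (\<Sum>z\<in>N w - {x}. \<phi> z)"
    by (rule sum.remove[OF finite_nbrs nbrs_sym[OF w]])
  then show ?thesis using sum.reindex_bij_betw[OF opposite_bij, of \<phi>] by simp
qed

text \<open>
  The jumps of \<open>g\<close> at \<open>w\<close> are those at \<open>x\<close>, transported along squares, except that the jump along the
  edge \<open>x w\<close> itself changes sign.
\<close>

lemma cubic_jumps_step:
  assumes g: "g \<in> E"
  shows "cubic_jumps g w = cubic_jumps g x - 2 * (g w - g x) ^ 3"
proof -
  have "cubic_jumps g w = (g x - g w) ^ 3 + (\<Sum>y\<in>N x - {w}. (g y - g x) ^ 3)"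
    using nbrs_in_verts[OF w] by (simp add: cubic_jumps_def sum_nbrs_opposite opposite_jump[OF _ g])
  also have "(g x - g w) ^ 3 = - ((g w - g x) ^ 3)"
    by (simp add: power3_eq_cube algebra_simps)
  also have "cubic_jumps g x = (g w - g x) ^ 3 + (\<Sum>y\<in>N x - {w}. (g y - g x) ^ 3)"
    using x by (simp add: cubic_jumps_def sum.remove[OF finite_nbrs w])
  ultimately show ?thesis by simp
qed

end

text \<open>
  A function in \<open>E\<close> that separates the ends of as many edges as possible separates the ends of every
  edge that any function in \<open>E\<close> separates: otherwise a small perturbation would do better.
\<close>

lemma ex_generic:
  "\<exists>f\<in>E. \<forall>x\<in>V. \<forall>y\<in>N x. f y = f x \<longrightarrow> (\<forall>g\<in>E. g y = g x)"
proof -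
  define A where "A = Sigma V N"
  define D where "D f = {(x, y) \<in> A. f y \<noteq> f x}" for f :: "'a \<Rightarrow> real"
  have finA: "finite A" unfolding A_def using finite_verts by auto
  have zero: "(\<lambda>_. 0) \<in> E" by (rule eigenspaceI) (auto simp: laplacian_nbrs)
  have "finite ((\<lambda>f. card (D f)) ` E)"
    by (rule finite_subset[of _ "{..card A}"]) (auto simp: D_def intro!: card_mono finA)
  moreover have "(\<lambda>f. card (D f)) ` E \<noteq> {}" using zero by auto
  ultimately have "Max ((\<lambda>f. card (D f)) ` E) \<in> (\<lambda>f. card (D f)) ` E" by (rule Max_in)
  then obtain f where f: "f \<in> E" and "card (D f) = Max ((\<lambda>f. card (D f)) ` E)" by auto
  then have max: "card (D g) \<le> card (D f)" if "g \<in> E" for g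
    using that \<open>finite ((\<lambda>f. card (D f)) ` E)\<close> by simp
  have "g y = g x" if x: "x \<in> V" and y: "y \<in> N x" and eq: "f y = f x" and g: "g \<in> E" for x y g
  proof (rule ccontr)
    assume ne: "g y \<noteq> g x"
    define bad where "bad = insert 0 ((\<lambda>(u, v). - (f v - f u) / (g v - g u)) ` A)"
    have "finite bad" unfolding bad_def using finA by simp
    then obtain c :: real where c: "c \<notin> bad" using ex_new_if_finite[OF infinite_UNIV_char_0] by blast
    define h where "h = (\<lambda>z. f z + c * g z)"
    have h: "h \<in> E" unfolding h_def by (rule eigenspace_add_scale[OF f g])
    have "D f \<subseteq> D h"
    proof
      fix e assume e: "e \<in> D f"
      obtain u v where uv: "e = (u, v)" by (cases e)
      have A: "(u, v) \<in> A" and fne: "f v \<noteq> f u" using e uv by (auto simp: D_def)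
      have "h v \<noteq> h u"
      proof
        assume "h v = h u"
        then have eq: "f v - f u = - (c * (g v - g u))" by (simp add: h_def algebra_simps)
        then have "g v - g u \<noteq> 0" using fne by auto
        then have "c = - (f v - f u) / (g v - g u)" using eq by (simp add: field_simps)
        then show False using c A by (force simp: bad_def)
      qed
      then show "e \<in> D h" using A uv by (simp add: D_def)
    qed
    moreover have "(x, y) \<in> D h" "(x, y) \<notin> D f"
      using x y eq ne c by (auto simp: D_def A_def h_def bad_def)
    ultimately have "D f \<subset> D h" by blast
    moreover have "finite (D h)" unfolding D_def by (rule finite_subset[OF _ finA]) auto
    ultimately have "card (D f) < card (D h)" by (rule psubset_card_mono[rotated])
    then show False using max[OF h] by simp
  qed
  then show ?thesis using f by blast
qed

text \<open>
  If nonempty, \<open>T\<close> is an atom among the sets of neighbours of \<open>x\<close> whose indicator functions occur as jumps at \<open>x\<close> of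
  functions in \<open>E\<close>.
\<close>

definition twin_block :: "'a \<Rightarrow> 'a set \<Rightarrow> ('a \<Rightarrow> real) \<Rightarrow> bool" where
  "twin_block x T f \<longleftrightarrow> x \<in> V \<and> T \<subseteq> N x \<and> f \<in> E
     \<and> (\<forall>y\<in>N x. f y - f x = (if y \<in> T then 1 else 0))
     \<and> (\<forall>g\<in>E. \<forall>y\<in>T. \<forall>y'\<in>T. g y = g y')"

text \<open>
  At the minimum \<open>x\<close> of a generic \<open>f \<in> E\<close>, the neighbours with larger value of \<open>f\<close> split into blocks on
  which all functions in \<open>E\<close> are constant.  A function in \<open>E\<close> is determined by its jumps on one
  representative per block, so the number of blocks is at least \<open>dim E \<ge> d / 2\<close>, and the blocks cannot
  all have three or more elements.
\<close>

lemma ex_small_twin_block: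
  assumes d: "0 < d" and mult: "d \<le> 2 * eigen_mult G 2"
  shows "\<exists>x T f. twin_block x T f \<and> (card T = 1 \<or> card T = 2)"
proof -
  obtain f where f: "f \<in> E" and generic: "\<And>x y g. x \<in> V \<Longrightarrow> y \<in> N x \<Longrightarrow> f y = f x \<Longrightarrow> g \<in> E \<Longrightarrow> g y = g x"
    using ex_generic by blast
  obtain x where x: "x \<in> V" and min: "\<And>y. y \<in> V \<Longrightarrow> f x \<le> f y"
    using finite_verts verts_nonempty
    by (metis arg_min_if_finite(1) arg_min_least)
  have ge: "f x \<le> f y" if "y \<in> N x" for y using min nbrs_in_verts[OF that] .
  define U where "U = {y \<in> N x. f x < f y}"
  have flat: "g y = g x" if "y \<in> N x - U" "g \<in> E" for y g
    using generic[OF x _ _ that(2), of y] ge that(1) by (force simp: U_def)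
  define S where "S = {s. \<exists>g\<in>E. \<forall>y\<in>N x. s y = g y - g x}"
  have add: "(\<lambda>y. s y + t y) \<in> S" if st: "s \<in> S" "t \<in> S" for s t
  proof -
    obtain g h where g: "g \<in> E" "\<forall>y\<in>N x. s y = g y - g x" and h: "h \<in> E" "\<forall>y\<in>N x. t y = h y - h x"
      using st unfolding S_def by blast
    show ?thesis unfolding S_def using eigenspace_add[OF g(1) h(1)] g(2) h(2)
      by (intro CollectI bexI[of _ "\<lambda>y. g y + h y"]) auto
  qed
  have scale: "(\<lambda>y. c * s y) \<in> S" if s: "s \<in> S" for s c
  proof -
    obtain g where g: "g \<in> E" "\<forall>y\<in>N x. s y = g y - g x" using s unfolding S_def by blast
    show ?thesis unfolding S_def using eigenspace_scale[OF g(1), of c] g(2)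
      by (intro CollectI bexI[of _ "\<lambda>y. c * g y"]) (auto simp: right_diff_distrib)
  qed
  have cube: "(\<lambda>y. s y ^ 3) \<in> S" if s: "s \<in> S" for s
  proof -
    obtain g where g: "g \<in> E" "\<forall>y\<in>N x. s y = g y - g x" using s unfolding S_def by blast
    \<comment> \<open>Passing from \<open>x\<close> to a neighbour changes \<open>cubic_jumps g\<close> by \<open>- 2\<close> times the cube of the jump.\<close>
    define h where "h = (\<lambda>y. (- 1 / 2) * cubic_jumps g y)"
    have h: "h \<in> E" unfolding h_def by (rule eigenspace_scale[OF cubic_jumps_in_E[OF g(1)]])
    have "s y ^ 3 = h y - h x" if y: "y \<in> N x" for y
    proof (cases "f x < f y")
      case True
      have "s y = g y - g x" using g(2) y by blast
      moreover have "cubic_jumps g y = cubic_jumps g x - 2 * (g y - g x) ^ 3"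
        using cubic_jumps_step[OF f x ge y True g(1)] by simp
      moreover have "a = - 1 / 2 * (c - 2 * a) - - 1 / 2 * c" for a c :: real by (simp add: field_simps)
      ultimately show ?thesis unfolding h_def by presburger
    next
      case False
      then have "y \<in> N x - U" using y by (simp add: U_def)
      then show ?thesis using flat[OF _ h, of y] flat[OF _ g(1), of y] g(2) y by simp
    qed
    then show ?thesis unfolding S_def using h by blast
  qed
  have fS: "(\<lambda>y. f y - f x) \<in> S" unfolding S_def using f by blast
  define cls where "cls w = {y \<in> U. \<forall>g\<in>E. g y = g w}" for w
  have finU: "finite U" by (simp add: U_def)
  have clsU: "cls w \<subseteq> U" for w unfolding cls_def by blast
  have block: "\<exists>h. twin_block x (cls w) h" if w: "w \<in> U" for w
  proof -
    have "\<exists>s\<in>S. \<forall>y\<in>U. s y = (if \<forall>t\<in>S. t y = t w then 1 else 0)"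
      by (rule cube_closed_indicator[OF finU add scale cube fS _ w]) (auto simp: U_def)
    then obtain s where s: "s \<in> S" "\<And>y. y \<in> U \<Longrightarrow> s y = (if \<forall>t\<in>S. t y = t w then 1 else 0)" by blast
    then obtain h where h: "h \<in> E" "\<And>y. y \<in> N x \<Longrightarrow> s y = h y - h x" unfolding S_def by blast
    have same: "(\<forall>t\<in>S. t y = t w) \<longleftrightarrow> (\<forall>g\<in>E. g y = g w)" if y: "y \<in> U" for y
    proof
      assume all: "\<forall>t\<in>S. t y = t w"
      show "\<forall>g\<in>E. g y = g w"
      proof
        fix g assume "g \<in> E"
        then have "(\<lambda>y. g y - g x) \<in> S" unfolding S_def by blast
        then show "g y = g w" using all by fastforce
      qed
    next
      assume all: "\<forall>g\<in>E. g y = g w"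
      show "\<forall>t\<in>S. t y = t w"
      proof
        fix t assume "t \<in> S"
        then obtain g where "g \<in> E" "\<forall>y\<in>N x. t y = g y - g x" unfolding S_def by blast
        then show "t y = t w" using all y w by (auto simp: U_def)
      qed
    qed
    have jump: "h y - h x = (if y \<in> cls w then 1 else 0)" if y: "y \<in> N x" for y
    proof (cases "y \<in> U")
      case True then show ?thesis using s(2)[OF True] h(2)[OF y] same[OF True] by (simp add: cls_def)
    next
      case False then show ?thesis using flat[OF _ h(1)] y by (simp add: cls_def)
    qed
    have sub: "cls w \<subseteq> N x" by (auto simp: cls_def U_def)
    have twins: "\<forall>g\<in>E. \<forall>y\<in>cls w. \<forall>y'\<in>cls w. g y = g y'" by (auto simp: cls_def)
    have "twin_block x (cls w) h"
      unfolding twin_block_def by (intro conjI x sub h(1) twins ballI jump)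
    then show ?thesis by blast
  qed
  have "\<exists>w\<in>U. card (cls w) \<le> 2"
  proof (rule ccontr)
    assume "\<not> ?thesis"
    then have "\<not> card (cls w) \<le> 2" if "w \<in> U" for w using that by blast
    then have big: "3 \<le> card c" if "c \<in> cls ` U" for c
      using that by (metis imageE not_less_eq_eq numeral_2_eq_2 numeral_3_eq_3)
    have self: "w \<in> cls w" if "w \<in> U" for w using that by (simp add: cls_def)
    define R where "R = (\<lambda>c. SOME y. y \<in> c) ` cls ` U"
    have R: "\<exists>r\<in>R. r \<in> cls w" if "w \<in> U" for w
    proof (rule bexI[of _ "SOME y. y \<in> cls w"])
      show "(SOME y. y \<in> cls w) \<in> cls w" using self[OF that] by (rule someI)
      show "(SOME y. y \<in> cls w) \<in> R" using that by (auto simp: R_def)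
    qed
    have "eigen_mult G 2 \<le> card R"
      unfolding eigen_mult_def
    proof (rule dim_le_card_functionals[OF eigenspace_subspace, where \<phi> = "\<lambda>r g. g r - g x"])
      show "finite R" using finU by (simp add: R_def)
      fix g assume g: "g \<in> E" and zero: "\<And>r. r \<in> R \<Longrightarrow> g r - g x = 0"
      have "g y = g x" if y: "y \<in> N x" for y
      proof (cases "y \<in> U")
        case True
        then obtain r where r: "r \<in> R" "r \<in> cls y" using R by blast
        then have "g r = g y" using g unfolding cls_def by blast
        then show ?thesis using zero[OF r(1)] by linarith
      next
        case False then show ?thesis using flat[OF _ g] y by blast
      qed
      then have "g z = 0" for z by (rule flat_imp_zero[OF g x])
      then show "g = 0" by (simp add: fun_eq_iff)
    qed (simp_all add: fun_scale_def right_diff_distrib)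
    also have "\<dots> \<le> card (cls ` U)" unfolding R_def by (rule card_image_le) (simp add: finU)
    finally have mult_le: "eigen_mult G 2 \<le> card (cls ` U)" .
    have "card (\<Union>(cls ` U)) = (\<Sum>c\<in>cls ` U. card c)"
    proof (rule card_Union_disjoint)
      have "cls y = cls w" if "z \<in> cls y" "z \<in> cls w" for y w z
      proof -
        have "g y = g w" if "g \<in> E" for g
          using \<open>z \<in> cls y\<close> \<open>z \<in> cls w\<close> that unfolding cls_def by (metis (mono_tags, lifting) mem_Collect_eq)
        then show ?thesis unfolding cls_def by (intro Collect_cong) metis
      qed
      then show "pairwise disjnt (cls ` U)" unfolding pairwise_def disjnt_def by blast
      show "finite c" if "c \<in> cls ` U" for c
        using that finite_subset[OF clsU finU] by blast
    qed
    also have "\<dots> \<ge> (\<Sum>c\<in>cls ` U. 3)" by (rule sum_mono) (rule big)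
    finally have "3 * card (cls ` U) \<le> card (\<Union>(cls ` U))" by simp
    also have "\<dots> \<le> card (N x)"
      by (rule card_mono[OF finite_nbrs]) (use clsU in \<open>auto simp: U_def\<close>)
    also have "\<dots> = d" by (rule card_nbrs[OF x])
    finally show False using mult_le mult d by simp
  qed
  then obtain w where w: "w \<in> U" "card (cls w) \<le> 2" by blast
  moreover have "card (cls w) > 0"
  proof -
    have "w \<in> cls w" using w(1) by (simp add: cls_def)
    then show ?thesis using finite_subset[OF clsU finU] card_gt_0_iff by blast
  qed
  ultimately have "card (cls w) = 1 \<or> card (cls w) = 2" by linarith
  then show ?thesis using block[OF w(1)] by blast
qed

end

section \<open>Fibring the graph over a level set\<close>

text \<open>
  Let \<open>r\<close> be the size of the block.  As \<open>f\<close> has jump sum \<open>- 2 f\<close>, it takes the value \<open>- r / 2\<close> at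
  \<open>x0\<close>; the values on the whole graph turn out to be \<open>- r / 2\<close>, \<open>- r / 2 + 1\<close> and, for \<open>r = 2\<close>,
  \<open>- r / 2 + 2\<close>.  The sets \<open>L0\<close>, \<open>L1\<close> and \<open>L2\<close> below are defined by climbing from vertices that
  look like \<open>x0\<close>, and it is then shown that they exhaust the graph.
\<close>

locale twin_fibration = cd2_graph +
  fixes x0 T f
  assumes block: "twin_block x0 T f" and small: "card T = 1 \<or> card T = 2"
begin

definition r :: real where "r = real (card T)"

definition ups :: "'a \<Rightarrow> 'a set" where
  "ups u = {y \<in> N u. f y = f u + 1}"

definition L0 :: "'a set" where
  "L0 = {u \<in> V. f u = - r / 2 \<and> card (ups u) = card T \<and> (\<forall>y\<in>N u - ups u. f y = f u)}"

definition L1 :: "'a set" where "L1 = (\<Union>u\<in>L0. ups u)"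

definition L2 :: "'a set" where "L2 = (\<Union>w\<in>L1. ups w)"

lemma f: "f \<in> E" and x0: "x0 \<in> V" and T: "T \<subseteq> N x0"
  using block unfolding twin_block_def by blast+

lemma f_x0:
  assumes "y \<in> N x0"
  shows "f y - f x0 = (if y \<in> T then 1 else 0)"
proof -
  have "\<forall>y\<in>N x0. f y - f x0 = (if y \<in> T then 1 else 0)" using block unfolding twin_block_def by blast
  then show ?thesis using assms by (rule bspec)
qed

lemma twins:
  assumes "g \<in> E" "y \<in> T" "y' \<in> T"
  shows "g y = g y'"
proof -
  have "\<forall>g\<in>E. \<forall>y\<in>T. \<forall>y'\<in>T. g y = g y'" using block unfolding twin_block_def by blast
  then show ?thesis using assms by blast
qed

lemma finite_ups [simp]: "finite (ups u)" by (simp add: ups_def)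

lemma ups_x0: "ups x0 = T"
proof -
  have "f y = f x0 + 1 \<longleftrightarrow> y \<in> T" if "y \<in> N x0" for y using f_x0[OF that] by (auto split: if_splits)
  then show ?thesis using T unfolding ups_def by blast
qed

lemma sum_jumps_ups:
  assumes "\<And>y. y \<in> N u \<Longrightarrow> f y = f u \<or> f y = f u + 1"
  shows "(\<Sum>y\<in>N u. f y - f u) = real (card (ups u))"
proof -
  have "(\<Sum>y\<in>N u. f y - f u) = (\<Sum>y\<in>N u. if f y = f u + 1 then 1 else 0)"
    by (intro sum.cong refl) (use assms in force)
  also have "\<dots> = real (card (ups u))"
    by (simp add: sum.If_cases ups_def Int_def)
  finally show ?thesis .
qed

lemma x0_L0: "x0 \<in> L0"
proof -
  have "f y = f x0 \<or> f y = f x0 + 1" if "y \<in> N x0" for y using f_x0[OF that] by (auto split: if_splits)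
  from sum_jumps_ups[OF this] have "r = - 2 * f x0"
    using sum_jumps[OF f x0] by (simp add: ups_x0 r_def)
  moreover have "f y = f x0" if "y \<in> N x0 - T" for y using f_x0[of y] that by simp
  ultimately show ?thesis using x0 by (simp add: L0_def ups_x0)
qed

lemma sum_sq_jumps: "u \<in> V \<Longrightarrow> (\<Sum>y\<in>N u. (f y - f u)\<^sup>2) = r"
proof -
  assume u: "u \<in> V"
  have "(\<Sum>y\<in>N x0. (f y - f x0)\<^sup>2) = (\<Sum>y\<in>N x0. if y \<in> T then 1 else 0)"
    by (intro sum.cong refl) (simp add: f_x0)
  also have "\<dots> = r" using T by (simp add: sum.If_cases r_def Int_absorb1 Int_absorb2)
  finally show ?thesis using sum_sq_jumps_const[OF f u x0] by simp
qed

lemma L0_V: "u \<in> L0 \<Longrightarrow> u \<in> V" and L0_f: "u \<in> L0 \<Longrightarrow> f u = - r / 2"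
  and L0_flat: "u \<in> L0 \<Longrightarrow> y \<in> N u - ups u \<Longrightarrow> f y = f u"
  and L0_card: "u \<in> L0 \<Longrightarrow> card (ups u) = card T"
  by (auto simp: L0_def)

lemma ups_N: "y \<in> ups u \<Longrightarrow> y \<in> N u" and ups_f: "y \<in> ups u \<Longrightarrow> f y = f u + 1"
  by (auto simp: ups_def)

lemma L0_ge: "u \<in> L0 \<Longrightarrow> y \<in> N u \<Longrightarrow> f u \<le> f y"
  using L0_flat[of u y] ups_f[of y u] by fastforce

lemma ups_gt: "y \<in> ups u \<Longrightarrow> f u < f y" by (simp add: ups_def)

lemma L0_opposite_props:
  assumes u: "u \<in> L0" and w: "w \<in> ups u" and y: "y \<in> N u - {w}"
  shows "opposite u w y \<in> N w - {u}" "opposite u w y \<in> N y"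
    "\<And>v. v \<in> N w \<Longrightarrow> v \<in> N y \<Longrightarrow> v \<noteq> u \<Longrightarrow> v = opposite u w y"
  using opposite_props[OF f L0_V[OF u] L0_ge[OF u] ups_N[OF w] ups_gt[OF w] y] by blast+

lemma L0_opposite_jump:
  assumes u: "u \<in> L0" and w: "w \<in> ups u" and y: "y \<in> N u - {w}" and g: "g \<in> E"
  shows "g (opposite u w y) - g w = g y - g u"
  using opposite_jump[OF f L0_V[OF u] L0_ge[OF u] ups_N[OF w] ups_gt[OF w] y g] by blast

lemma L0_opposite_image:
  assumes u: "u \<in> L0" and w: "w \<in> ups u"
  shows "opposite u w ` (N u - {w}) = N w - {u}"
  using opposite_bij[OF f L0_V[OF u] L0_ge[OF u] ups_N[OF w] ups_gt[OF w]] by (auto simp: bij_betw_def)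

lemma L0_sum_opposite:
  fixes \<phi> :: "'a \<Rightarrow> real"
  assumes u: "u \<in> L0" and w: "w \<in> ups u"
  shows "(\<Sum>z\<in>N w. \<phi> z) = \<phi> u + (\<Sum>y\<in>N u - {w}. \<phi> (opposite u w y))"
  using sum_nbrs_opposite[OF f L0_V[OF u] L0_ge[OF u] ups_N[OF w] ups_gt[OF w], of \<phi>] by blast

text \<open>
  A neighbour \<open>z\<close> of \<open>y\<close> can be higher than \<open>u\<close> only if it is adjacent to an upper neighbour of \<open>u\<close>,
  since otherwise the midpoint rule for \<open>u\<close> and \<open>z\<close> involves only values equal to \<open>f u\<close>.
\<close>

lemma flat_step:
  assumes u: "u \<in> L0" and y: "y \<in> N u" "f y = f u" and z: "z \<in> N y"
  shows "f z = f u \<or> f z = f u + 1 \<and> (\<exists>w\<in>ups u. z = opposite u w y \<and> z \<in> N w)"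
proof (cases "z = u")
  case True then show ?thesis by simp
next
  case False
  have zV: "z \<in> V" using z nbrs_in_verts by auto
  have yz: "y \<in> N u \<inter> N z" using y z nbrs_sym by auto
  show ?thesis
  proof (cases "\<exists>w\<in>ups u. z \<in> N w")
    case True
    then obtain w where w: "w \<in> ups u" "z \<in> N w" by blast
    have yw: "y \<in> N u - {w}" using y ups_f[OF w(1)] by auto
    have zo: "z = opposite u w y"
      using L0_opposite_props(3)[OF u w(1) yw w(2) z False] .
    have "f (opposite u w y) - f w = f y - f u"
      using L0_opposite_jump[OF u w(1) yw f] .
    then have "f z = f u + 1" using zo y(2) ups_f[OF w(1)] by simp
    then show ?thesis using w zo by blast
  next
    case none: False
    have "(\<Sum>v\<in>N u \<inter> N z. f v - f u) = 0"
    proof (rule sum.neutral, rule ballI)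
      fix v assume "v \<in> N u \<inter> N z"
      then have "v \<in> N u - ups u" using none nbrs_sym by auto
      then show "f v - f u = 0" using L0_flat[OF u] by simp
    qed
    then have "codeg u z * (f z - f u) = 0" using codeg_jump[OF f L0_V[OF u] zV False] by simp
    moreover have "codeg u z \<noteq> 0" using yz by (auto simp: codeg_def)
    ultimately show ?thesis by simp
  qed
qed

text \<open>All jumps at \<open>y\<close> are zero or one, and their sum \<open>- 2 f y = r\<close> counts the upper neighbours.\<close>

lemma flat_nbr_L0:
  assumes u: "u \<in> L0" and y: "y \<in> N u" "f y = f u"
  shows "y \<in> L0"
proof -
  have yV: "y \<in> V" using y nbrs_in_verts by auto
  have step: "f z = f y \<or> f z = f y + 1" if "z \<in> N y" for z
    using flat_step[OF u y that] y(2) by auto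
  have "real (card (ups y)) = r"
    using sum_jumps_ups[OF step] sum_jumps[OF f yV] L0_f[OF u] y(2) by simp
  then show ?thesis using yV step L0_f[OF u] y(2) by (auto simp: L0_def ups_def r_def)
qed

lemma flat_nbr_L0': "u \<in> L0 \<Longrightarrow> y \<in> N u - ups u \<Longrightarrow> y \<in> L0"
  using flat_nbr_L0 L0_flat by blast

text \<open>
  The squares at \<open>u\<close> along the edge \<open>u w\<close> describe all neighbours of \<open>w\<close> other than \<open>u\<close>.
\<close>

lemma nbrs_L1:
  assumes u: "u \<in> L0" and w: "w \<in> ups u" and z: "z \<in> N w"
  obtains "z = u"
    | y where "y \<in> ups u - {w}" "z = opposite u w y" "z \<in> ups w" "z \<in> ups y"
    | y where "y \<in> N u - ups u" "y \<in> L0" "z = opposite u w y" "f z = f w" "z \<in> ups y"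
proof (cases "z = u")
  case True then show ?thesis using that(1) by blast
next
  case False
  then have "z \<in> opposite u w ` (N u - {w})"
    using L0_opposite_image[OF u w] z by auto
  then obtain y where y: "y \<in> N u - {w}" and zy: "z = opposite u w y" by blast
  have jump: "f z - f w = f y - f u" unfolding zy using L0_opposite_jump[OF u w y f] .
  have zNy: "z \<in> N y" unfolding zy using L0_opposite_props(2)[OF u w y] .
  show ?thesis
  proof (cases "y \<in> ups u")
    case True
    then have "f z = f w + 1" "f z = f y + 1" using jump ups_f[OF True] ups_f[OF w] by simp_all
    then show ?thesis using that(2)[of y] True y zy z zNy by (auto simp: ups_def)
  next
    case flat: False
    then have fy: "f y = f u" using L0_flat[OF u] y by simp
    then have "f z = f w" "f z = f y + 1" using jump ups_f[OF w] by simp_all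
    then show ?thesis using that(3)[of y] flat y zy z zNy flat_nbr_L0'[OF u, of y] by (auto simp: ups_def)
  qed
qed

lemma lower_nbr_unique:
  assumes u: "u \<in> L0" and w: "w \<in> ups u" and z: "z \<in> N w" "f z < f w"
  shows "z = u"
  by (rule nbrs_L1[OF u w z(1)]) (use z(2) ups_f in auto)

lemma L1_f: "w \<in> L1 \<Longrightarrow> f w = - r / 2 + 1"
  using L0_f ups_f by (force simp: L1_def)

text \<open>
  The two downward jumps at \<open>z\<close> use up the energy \<open>r = 2\<close>, so there are no further jumps at \<open>z\<close>.
\<close>

lemma nbrs_L2:
  assumes u: "u \<in> L0" and w: "w \<in> ups u" and z: "z \<in> ups w"
  obtains w' where "w' \<noteq> w" "ups u = {w, w'}" "z \<in> ups w'" "r = 2" "z = opposite u w w'"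
    "\<And>y. y \<in> N z - {w, w'} \<Longrightarrow> f y = f z"
proof -
  obtain w' where w': "w' \<in> ups u - {w}" "z = opposite u w w'" "z \<in> ups w'"
    by (rule nbrs_L1[OF u w ups_N[OF z]]) (use ups_f[OF z] ups_f[OF w] in auto)
  have "card {w, w'} \<le> card (ups u)" by (rule card_mono) (use w w' in auto)
  moreover have c2: "card {w, w'} = 2" using w' by auto
  ultimately have T2: "card T = 2" using L0_card[OF u] small by auto
  then have ups_u: "ups u = {w, w'}"
    using L0_card[OF u] card_subset_eq[of "ups u" "{w, w'}"] c2 w w' by auto
  have zV: "z \<in> V" using z ups_N nbrs_in_verts by blast
  have zw: "w \<in> N z" "w' \<in> N z" using z w' ups_N nbrs_sym by blast+
  have "(\<Sum>y\<in>N z. (f y - f z)\<^sup>2) = (f w - f z)\<^sup>2 + ((f w' - f z)\<^sup>2 + (\<Sum>y\<in>N z - {w} - {w'}. (f y - f z)\<^sup>2))"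
  proof -
    have "w' \<in> N z - {w}" using zw w'(1) by blast
    from sum.remove[OF _ this, of "\<lambda>y. (f y - f z)\<^sup>2"] show ?thesis
      unfolding sum.remove[OF finite_nbrs zw(1)] by simp
  qed
  then have "(\<Sum>y\<in>N z - {w} - {w'}. (f y - f z)\<^sup>2) = 0"
    using sum_sq_jumps[OF zV] T2 ups_f[OF z] ups_f[OF w'(3)] by (simp add: r_def)
  then have "\<forall>y\<in>N z - {w} - {w'}. (f y - f z)\<^sup>2 = 0"
    by (subst (asm) sum_nonneg_eq_0_iff) auto
  then show ?thesis using that[of w'] w' ups_u T2 by (auto simp: r_def)
qed

text \<open>
  A vertex \<open>z\<close> of the top level is a local minimum of \<open>- f\<close>, so the squares at \<open>z\<close> along a downward edge
  describe the neighbours of \<open>w\<close> once more.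
\<close>

lemma nbrs_L2_flat:
  fixes \<phi> :: "'a \<Rightarrow> real"
  assumes u: "u \<in> L0" and w: "w \<in> ups u" and z: "z \<in> ups w" and y: "y \<in> N z - {w}"
  shows "opposite z w y \<in> N w - {z}" "opposite z w y \<in> N y"
    "f (opposite z w y) - f w = f y - f z"
    "\<And>v. v \<in> N w \<Longrightarrow> v \<in> N y \<Longrightarrow> v \<noteq> z \<Longrightarrow> v = opposite z w y"
    "(\<Sum>v\<in>N w. \<phi> v) = \<phi> z + (\<Sum>y\<in>N z - {w}. \<phi> (opposite z w y))"
proof -
  obtain w' where w': "w' \<noteq> w" "ups u = {w, w'}" "z \<in> ups w'"
    "\<And>y. y \<in> N z - {w, w'} \<Longrightarrow> f y = f z"
    by (rule nbrs_L2[OF u w z]) blast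
  have zV: "z \<in> V" using z ups_N nbrs_in_verts by blast
  have wz: "w \<in> N z" using z ups_N nbrs_sym by blast
  have ge: "- f z \<le> - f v" if "v \<in> N z" for v
    using w'(4)[of v] that ups_f[OF z] ups_f[OF w'(3)] by fastforce
  have gt: "- f z < - f w" using ups_f[OF z] by simp
  note mf = eigenspace_uminus[OF f]
  show "opposite z w y \<in> N w - {z}" "opposite z w y \<in> N y"
    "\<And>v. v \<in> N w \<Longrightarrow> v \<in> N y \<Longrightarrow> v \<noteq> z \<Longrightarrow> v = opposite z w y"
    using opposite_props[OF mf zV ge wz gt y] by blast+
  show "f (opposite z w y) - f w = f y - f z"
    using opposite_jump[OF mf zV ge wz gt y f] by blast
  show "(\<Sum>v\<in>N w. \<phi> v) = \<phi> z + (\<Sum>y\<in>N z - {w}. \<phi> (opposite z w y))"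
    using sum_nbrs_opposite[OF mf zV ge wz gt, of \<phi>] by blast
qed

lemma flat_nbr_L2:
  assumes u: "u \<in> L0" and w: "w \<in> ups u" and z: "z \<in> ups w" and y: "y \<in> N z - {w}" and fy: "f y = f z"
  shows "opposite z w y \<in> N w - ups w - {u}" "opposite z w y \<in> L1" "y \<in> ups (opposite z w y)"
proof -
  note o = nbrs_L2_flat[OF u w z y]
  have fo: "f (opposite z w y) = f w" using o(3) fy by simp
  show 1: "opposite z w y \<in> N w - ups w - {u}"
    using o(1) fo ups_f[OF w] by (auto simp: ups_def)
  have "opposite z w y \<in> N w" using o(1) by simp
  then show "opposite z w y \<in> L1"
    by (rule nbrs_L1[OF u w]) (use 1 in \<open>auto simp: L1_def\<close>)
  show "y \<in> ups (opposite z w y)"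
    using nbrs_sym[OF o(2)] fo fy ups_f[OF z] by (simp add: ups_def)
qed

lemma all_levels: "V = L0 \<union> L1 \<union> L2"
proof -
  have sub: "L0 \<union> L1 \<union> L2 \<subseteq> V"
    using L0_V ups_N nbrs_in_verts by (auto simp: L1_def L2_def) blast+
  have "L0 \<union> L1 \<union> L2 = V"
  proof (rule closed_imp_all[OF sub])
    show "L0 \<union> L1 \<union> L2 \<noteq> {}" using x0_L0 by auto
    fix v assume v: "v \<in> L0 \<union> L1 \<union> L2"
    show "N v \<subseteq> L0 \<union> L1 \<union> L2"
    proof
      fix y assume y: "y \<in> N v"
      consider "v \<in> L0" | u where "u \<in> L0" "v \<in> ups u"
        | u w where "u \<in> L0" "w \<in> ups u" "v \<in> ups w"
        using v by (auto simp: L1_def L2_def)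
      then show "y \<in> L0 \<union> L1 \<union> L2"
      proof cases
        case 1
        then show ?thesis using flat_nbr_L0'[OF 1, of y] y by (auto simp: L1_def)
      next
        case 2
        show ?thesis
          by (rule nbrs_L1[OF 2 y]) (use 2 in \<open>auto simp: L1_def L2_def\<close>)
      next
        case 3
        obtain w' where w': "w' \<noteq> w" "ups u = {w, w'}" "v \<in> ups w'"
          "\<And>y. y \<in> N v - {w, w'} \<Longrightarrow> f y = f v"
          by (rule nbrs_L2[OF 3]) blast
        show ?thesis
        proof (cases "y \<in> {w, w'}")
          case True then show ?thesis using w'(2) 3(1) by (auto simp: L1_def)
        next
          case False
          then have "y \<in> N v - {w}" "f y = f v" using w'(4)[of y] y by auto
          then show ?thesis using flat_nbr_L2[OF 3, of y] by (auto simp: L2_def)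
        qed
      qed
    qed
  qed
  then show ?thesis by simp
qed

text \<open>
  The projection goes down to the lowest level.  A vertex of \<open>L2\<close> has two ways down, which end at the
  same vertex because both of its lower neighbours are upper neighbours of one vertex of \<open>L0\<close>.
\<close>

definition over :: "'a \<Rightarrow> 'a \<Rightarrow> bool" where
  "over v u \<longleftrightarrow> u \<in> L0 \<and> (v = u \<or> v \<in> ups u \<or> (\<exists>w\<in>ups u. v \<in> ups w))"

lemma over_unique:
  assumes "over v u" "over v u'"
  shows "u = u'"
proof -
  have u: "u \<in> L0" "u' \<in> L0" using assms by (auto simp: over_def)
  have eq: "f u = f u'" using L0_f u by simp
  consider "v = u" | "v \<in> ups u" | w where "w \<in> ups u" "v \<in> ups w" using assms by (auto simp: over_def)
  then show ?thesis
  proof cases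
    case 1
    then show ?thesis using assms(2) eq ups_f by (fastforce simp: over_def)
  next
    case 2
    have "f v = f u' + 1" using ups_f[OF 2] eq by simp
    then have "v \<in> ups u'" using assms(2) ups_f by (fastforce simp: over_def)
    then have "u' \<in> N v" "f u' < f v" using ups_N nbrs_sym ups_gt by blast+
    then show ?thesis using lower_nbr_unique[OF u(1) 2] by simp
  next
    case 3
    obtain w' where w': "ups u = {w, w'}" "\<And>y. y \<in> N v - {w, w'} \<Longrightarrow> f y = f v"
      by (rule nbrs_L2[OF u(1) 3]) blast
    have "f v = f u' + 2" using ups_f 3 eq by force
    then obtain q where q: "q \<in> ups u'" "v \<in> ups q" using assms(2) ups_f by (fastforce simp: over_def)
    then have "q \<in> N v" "f q < f v" using ups_N nbrs_sym ups_gt by blast+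
    then have "q \<in> ups u" using w' by auto
    moreover have "u' \<in> N q" "f u' < f q" using q ups_N nbrs_sym ups_gt by blast+
    ultimately show ?thesis using lower_nbr_unique[OF u(1)] by metis
  qed
qed

definition \<pi> :: "'a \<Rightarrow> 'a" where "\<pi> v = (THE u. over v u)"

lemma \<pi>_eq: "over v u \<Longrightarrow> \<pi> v = u"
  unfolding \<pi>_def using over_unique by blast

lemma \<pi>_L0 [simp]: "u \<in> L0 \<Longrightarrow> \<pi> u = u"
  and \<pi>_L1: "u \<in> L0 \<Longrightarrow> w \<in> ups u \<Longrightarrow> \<pi> w = u"
  and \<pi>_L2: "u \<in> L0 \<Longrightarrow> w \<in> ups u \<Longrightarrow> z \<in> ups w \<Longrightarrow> \<pi> z = u"
  by (rule \<pi>_eq, auto simp: over_def)+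

lemma \<pi>_ups: "w \<in> L1 \<Longrightarrow> z \<in> ups w \<Longrightarrow> \<pi> z = \<pi> w"
  using \<pi>_L1 \<pi>_L2 by (auto simp: L1_def)

lemma \<pi>_in: "v \<in> V \<Longrightarrow> \<pi> v \<in> L0"
  using all_levels \<pi>_L1 \<pi>_L2 by (auto simp: L1_def L2_def)

lemma verts_cases:
  assumes "v \<in> V"
  obtains "v \<in> L0" | u where "u \<in> L0" "v \<in> ups u"
    | u w where "u \<in> L0" "w \<in> ups u" "v \<in> ups w"
  using assms all_levels by (auto simp: L1_def L2_def)

definition B :: "'a pair_pre_digraph" where
  "B = \<lparr> pverts = L0, parcs = {(u, v). u \<in> L0 \<and> v \<in> L0 \<and> v \<in> N u} \<rparr>"

lemma pverts_B: "pverts B = L0"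
  and parcs_B: "parcs B = {(u, v). u \<in> L0 \<and> v \<in> L0 \<and> v \<in> N u}"
  by (simp_all add: B_def)

lemma in_nbrs_B: "v \<in> nbrs B u \<longleftrightarrow> u \<in> L0 \<and> v \<in> L0 \<and> v \<in> N u"
  unfolding nbrs_def[of B] parcs_B by simp

lemma nbrs_B: "u \<in> L0 \<Longrightarrow> nbrs B u = N u - ups u"
proof -
  assume u: "u \<in> L0"
  have "v \<notin> ups u" if "v \<in> L0" for v using ups_f[of v u] L0_f[OF u] L0_f[OF that] by auto
  moreover have "nbrs B u = {v \<in> L0. v \<in> N u}" using u by (auto simp: in_nbrs_B)
  ultimately show ?thesis using flat_nbr_L0'[OF u] by blast
qed

lemma \<pi>_opposite_L1:
  assumes u: "u \<in> L0" and w: "w \<in> ups u" and y: "y \<in> N u - {w}"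
  shows "\<pi> (opposite u w y) = \<pi> y"
proof -
  have oN: "opposite u w y \<in> N w" "opposite u w y \<noteq> u" "opposite u w y \<in> N y"
    using L0_opposite_props[OF u w y] by auto
  have jump: "f (opposite u w y) - f w = f y - f u"
    using L0_opposite_jump[OF u w y f] .
  show ?thesis
  proof (cases "y \<in> ups u")
    case True
    then have "opposite u w y \<in> ups w" using oN jump ups_f[OF True] by (simp add: ups_def)
    then show ?thesis using \<pi>_L2[OF u w] \<pi>_L1[OF u True] by simp
  next
    case False
    then have yL: "y \<in> L0" "f y = f u" using flat_nbr_L0'[OF u, of y] L0_flat[OF u, of y] y by auto
    then have "opposite u w y \<in> ups y" using oN jump ups_f[OF w] by (simp add: ups_def)
    then show ?thesis using \<pi>_L1[OF yL(1)] yL by simp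
  qed
qed

lemma \<pi>_opposite_L2:
  assumes u: "u \<in> L0" and w: "w \<in> ups u" and z: "z \<in> ups w" and y: "y \<in> N z - {w}"
  shows "\<pi> (opposite z w y) = \<pi> y"
proof -
  obtain w' where w': "w' \<noteq> w" "ups u = {w, w'}" "z \<in> ups w'"
    "\<And>y. y \<in> N z - {w, w'} \<Longrightarrow> f y = f z"
    by (rule nbrs_L2[OF u w z]) blast
  show ?thesis
  proof (cases "y = w'")
    case True
    have "u \<in> N w" "u \<in> N w'" using w w'(2) ups_N nbrs_sym by blast+
    moreover have "u \<noteq> z" using ups_f[OF z] ups_f[OF w] by auto
    ultimately have "opposite z w y = u" using nbrs_L2_flat(4)[OF u w z y] True by metis
    then show ?thesis using True w'(2) u \<pi>_L1[OF u, of w'] by simp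
  next
    case False
    then have "f y = f z" using w'(4)[of y] y by auto
    from flat_nbr_L2[OF u w z y this] show ?thesis using \<pi>_ups by simp
  qed
qed

text \<open>
  Along a vertical edge the remaining neighbours of the two ends are matched by squares, and vertices
  matched in this way have the same projection.
\<close>

lemma sum_\<pi>_vertical:
  fixes \<phi> :: "'a \<Rightarrow> real"
  assumes v: "v \<in> V"
  shows "(\<Sum>y\<in>N v. \<phi> (\<pi> y)) = (\<Sum>y\<in>N (\<pi> v). \<phi> (\<pi> y))"
proof -
  have one: "(\<Sum>y\<in>N w. \<phi> (\<pi> y)) = (\<Sum>y\<in>N u. \<phi> (\<pi> y))" if u: "u \<in> L0" and w: "w \<in> ups u" for u w
  proof -
    have "(\<Sum>y\<in>N w. \<phi> (\<pi> y)) = \<phi> (\<pi> u) + (\<Sum>y\<in>N u - {w}. \<phi> (\<pi> (opposite u w y)))"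
      by (rule L0_sum_opposite[OF u w])
    also have "\<dots> = \<phi> (\<pi> w) + (\<Sum>y\<in>N u - {w}. \<phi> (\<pi> y))"
      using u w by (simp add: \<pi>_opposite_L1 \<pi>_L1)
    also have "\<dots> = (\<Sum>y\<in>N u. \<phi> (\<pi> y))"
      by (rule sum.remove[OF finite_nbrs ups_N[OF w], symmetric])
    finally show ?thesis .
  qed
  have two: "(\<Sum>y\<in>N z. \<phi> (\<pi> y)) = (\<Sum>y\<in>N w. \<phi> (\<pi> y))"
    if u: "u \<in> L0" and w: "w \<in> ups u" and z: "z \<in> ups w" for u w z
  proof -
    have wz: "w \<in> N z" using z ups_N nbrs_sym by blast
    obtain w' where w': "w' \<in> N z - {w}"
      using nbrs_L2[OF u w z] ups_N nbrs_sym by (metis Diff_iff singletonD)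
    have "(\<Sum>y\<in>N w. \<phi> (\<pi> y)) = \<phi> (\<pi> z) + (\<Sum>y\<in>N z - {w}. \<phi> (\<pi> (opposite z w y)))"
      by (rule nbrs_L2_flat(5)[OF u w z w'])
    also have "\<dots> = \<phi> (\<pi> w) + (\<Sum>y\<in>N z - {w}. \<phi> (\<pi> y))"
      using u w z by (simp add: \<pi>_opposite_L2 \<pi>_L1 \<pi>_L2)
    also have "\<dots> = (\<Sum>y\<in>N z. \<phi> (\<pi> y))"
      by (rule sum.remove[OF finite_nbrs wz, symmetric])
    finally show ?thesis by simp
  qed
  from v show ?thesis
    by (cases rule: verts_cases) (simp_all add: one two \<pi>_L1 \<pi>_L2)
qed

lemma card_nbrs_B:
  assumes u: "u \<in> L0"
  shows "card (nbrs B u) = d - card T" "card T \<le> d"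
proof -
  have sub: "ups u \<subseteq> N u" by (auto simp: ups_def)
  show "card (nbrs B u) = d - card T"
    unfolding nbrs_B[OF u] using card_Diff_subset[OF finite_ups sub] card_nbrs[OF L0_V[OF u]] L0_card[OF u] by simp
  show "card T \<le> d" using card_mono[OF finite_nbrs sub] card_nbrs[OF L0_V[OF u]] L0_card[OF u] by simp
qed

text \<open>
  The intertwining property from which everything about \<open>B\<close> follows: of the neighbours of \<open>v\<close>, \<open>r\<close>
  lie in the fibre of \<open>v\<close>, and the others project bijectively to the neighbours of \<open>\<pi> v\<close> in \<open>B\<close>.
\<close>

lemma laplacian_lift:
  assumes v: "v \<in> V"
  shows "L (\<lambda>y. \<phi> (\<pi> y)) v = laplacian B \<phi> (\<pi> v)"
proof -
  let ?u = "\<pi> v"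
  have u: "?u \<in> L0" using \<pi>_in[OF v] .
  have sub: "ups ?u \<subseteq> N ?u" by (auto simp: ups_def)
  have "L (\<lambda>y. \<phi> (\<pi> y)) v = (\<Sum>y\<in>N ?u. \<phi> (\<pi> y)) - real d * \<phi> ?u"
    unfolding laplacian_eq[OF v] sum_\<pi>_vertical[OF v, symmetric] ..
  also have "(\<Sum>y\<in>N ?u. \<phi> (\<pi> y)) = (\<Sum>y\<in>N ?u - ups ?u. \<phi> (\<pi> y)) + (\<Sum>y\<in>ups ?u. \<phi> (\<pi> y))"
    by (rule sum.subset_diff[OF sub finite_nbrs])
  also have "(\<Sum>y\<in>N ?u - ups ?u. \<phi> (\<pi> y)) = (\<Sum>y\<in>nbrs B ?u. \<phi> y)"
    unfolding nbrs_B[OF u] by (intro sum.cong refl arg_cong[of _ _ \<phi>] \<pi>_L0 flat_nbr_L0'[OF u])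
  also have "(\<Sum>y\<in>ups ?u. \<phi> (\<pi> y)) = (\<Sum>y\<in>ups ?u. \<phi> ?u)"
    by (intro sum.cong refl arg_cong[of _ _ \<phi>] \<pi>_L1[OF u])
  also have "\<dots> = r * \<phi> ?u" using L0_card[OF u] by (simp add: r_def)
  finally have "L (\<lambda>y. \<phi> (\<pi> y)) v = (\<Sum>y\<in>nbrs B ?u. \<phi> y) - (real d - r) * \<phi> ?u"
    by (simp add: algebra_simps)
  also have "\<dots> = laplacian B \<phi> ?u"
    using card_nbrs_B[OF u] by (simp add: laplacian_nbrs sum_subtractf r_def of_nat_diff)
  finally show ?thesis .
qed

lemma \<pi>_edge:
  assumes v: "v \<in> V" and y: "y \<in> N v"
  shows "\<pi> y = \<pi> v \<or> \<pi> y \<in> nbrs B (\<pi> v)"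
proof -
  have zero: "\<pi> y = \<pi> u \<or> \<pi> y \<in> nbrs B (\<pi> u)" if u: "u \<in> L0" and y: "y \<in> N u" for u y
  proof (cases "y \<in> ups u")
    case True then show ?thesis using \<pi>_L1[OF u] u by simp
  next
    case False
    then have "y \<in> nbrs B u" "y \<in> L0" using y u nbrs_B flat_nbr_L0'[OF u] by auto
    then show ?thesis using u by simp
  qed
  have one: "\<pi> y = \<pi> w \<or> \<pi> y \<in> nbrs B (\<pi> w)" if u: "u \<in> L0" and w: "w \<in> ups u" and y: "y \<in> N w" for u w y
  proof (cases "y = u")
    case True then show ?thesis using \<pi>_L1[OF u w] u by simp
  next
    case False
    then have "y \<in> opposite u w ` (N u - {w})"
      using L0_opposite_image[OF u w] y by auto
    then obtain y' where y': "y' \<in> N u - {w}" "y = opposite u w y'" by blast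
    then show ?thesis using \<pi>_opposite_L1[OF u w y'(1)] zero[OF u, of y'] \<pi>_L1[OF u w] u by simp
  qed
  have two: "\<pi> y = \<pi> z \<or> \<pi> y \<in> nbrs B (\<pi> z)"
    if u: "u \<in> L0" and w: "w \<in> ups u" and z: "z \<in> ups w" and y: "y \<in> N z" for u w z y
  proof (cases "y = w")
    case True then show ?thesis using \<pi>_L1[OF u w] \<pi>_L2[OF u w z] by simp
  next
    case False
    then have y': "y \<in> N z - {w}" using y by simp
    have "opposite z w y \<in> N w" using nbrs_L2_flat(1)[OF u w z y'] by simp
    from one[OF u w this] show ?thesis
      using \<pi>_opposite_L2[OF u w z y'] \<pi>_L1[OF u w] \<pi>_L2[OF u w z] by simp
  qed
  from v show ?thesis
  proof (cases rule: verts_cases)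
    case 1 then show ?thesis using zero y by simp
  next
    case (2 u) then show ?thesis using one y by blast
  next
    case (3 u w) then show ?thesis using two y by blast
  qed
qed

lemma connected_regular_B: "connected_regular_graph B (d - card T)"
proof
  show "finite (pverts B)" using finite_subset[OF _ finite_verts, of L0] L0_V by (auto simp: pverts_B)
  show "pverts B \<noteq> {}" using x0_L0 by (auto simp: pverts_B)
  show "nbrs B x \<subseteq> pverts B" for x by (auto simp: in_nbrs_B pverts_B)
  show "x \<in> pverts B" if "y \<in> nbrs B x" for x y using that by (simp add: in_nbrs_B pverts_B)
  show "x \<in> nbrs B y" if "y \<in> nbrs B x" for x y
    using that nbrs_sym by (auto simp: in_nbrs_B)
  show "x \<notin> nbrs B x" for x using nbrs_irrefl by (simp add: in_nbrs_B)
  show "card (nbrs B x) = d - card T" if "x \<in> pverts B" for x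
    using that card_nbrs_B by (simp add: pverts_B)
  fix S assume S: "S \<subseteq> pverts B" "S \<noteq> {}" and closed: "\<And>x. x \<in> S \<Longrightarrow> nbrs B x \<subseteq> S"
  have SL: "S \<subseteq> L0" using S by (simp add: pverts_B)
  have "{v \<in> V. \<pi> v \<in> S} = V"
  proof (rule closed_imp_all)
    obtain s where s: "s \<in> S" using S by auto
    then have "s \<in> L0" using SL by auto
    then show "{v \<in> V. \<pi> v \<in> S} \<noteq> {}" using s L0_V[of s] \<pi>_L0[of s] by force
    fix v assume v: "v \<in> {v \<in> V. \<pi> v \<in> S}"
    show "N v \<subseteq> {v \<in> V. \<pi> v \<in> S}"
    proof
      fix y assume y: "y \<in> N v"
      have "\<pi> y \<in> S" using \<pi>_edge[of v y] closed[of "\<pi> v"] v y by auto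
      then show "y \<in> {v \<in> V. \<pi> v \<in> S}" using nbrs_in_verts[OF y] by simp
    qed
  qed auto
  then have "L0 \<subseteq> S" using L0_V \<pi>_L0 by (metis (mono_tags, lifting) mem_Collect_eq subsetI)
  then show "S = pverts B" using SL by (auto simp: pverts_B)
qed

sublocale B: connected_regular_graph B "d - card T"
  by (rule connected_regular_B)

lemma Gamma_lift:
  assumes "v \<in> V"
  shows "Gamma G (\<lambda>y. h (\<pi> y)) (\<lambda>y. k (\<pi> y)) v = Gamma B h k (\<pi> v)"
  unfolding Gamma_def using laplacian_lift[OF assms, of "\<lambda>u. h u * k u"] by (simp add: laplacian_lift[OF assms])

lemma Gamma2_lift:
  assumes v: "v \<in> V"
  shows "Gamma2 G (\<lambda>y. h (\<pi> y)) (\<lambda>y. k (\<pi> y)) v = Gamma2 B h k (\<pi> v)"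
proof -
  let ?h = "\<lambda>y. h (\<pi> y)" and ?k = "\<lambda>y. k (\<pi> y)"
  have "L (Gamma G ?h ?k) v = L (\<lambda>y. Gamma B h k (\<pi> y)) v"
    by (rule laplacian_cong[OF v]) (rule Gamma_lift)
  also have "\<dots> = laplacian B (Gamma B h k) (\<pi> v)" by (rule laplacian_lift[OF v])
  finally have 1: "L (Gamma G ?h ?k) v = laplacian B (Gamma B h k) (\<pi> v)" .
  have "Gamma G ?h (L ?k) v = Gamma G ?h (\<lambda>y. laplacian B k (\<pi> y)) v"
    by (rule Gamma_cong[OF v]) (simp_all add: laplacian_lift)
  then have 2: "Gamma G ?h (L ?k) v = Gamma B h (laplacian B k) (\<pi> v)"
    by (simp add: Gamma_lift[OF v])
  have "Gamma G ?k (L ?h) v = Gamma G ?k (\<lambda>y. laplacian B h (\<pi> y)) v"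
    by (rule Gamma_cong[OF v]) (simp_all add: laplacian_lift)
  then have 3: "Gamma G ?k (L ?h) v = Gamma B k (laplacian B h) (\<pi> v)"
    by (simp add: Gamma_lift[OF v])
  show ?thesis unfolding Gamma2_def 1 2 3 ..
qed

lemma CD_B: "CD_inf B 2"
  unfolding CD_inf_def pverts_B
proof (intro allI ballI)
  fix h u assume u: "u \<in> L0"
  show "2 * Gamma B h h u \<le> Gamma2 B h h u"
    using cd L0_V[OF u] Gamma_lift[OF L0_V[OF u], of h h] Gamma2_lift[OF L0_V[OF u], of h h] u
    by (simp add: CD_inf_def) metis
qed

sublocale B: cd2_graph B "d - card T"
  by unfold_locales (rule CD_B)

definition lift :: "('a \<Rightarrow> real) \<Rightarrow> 'a \<Rightarrow> real" where
  "lift h v = (if v \<in> V then h (\<pi> v) else 0)"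

lemma lift_in_E:
  assumes h: "h \<in> B.E"
  shows "lift h \<in> E"
proof (rule eigenspaceI)
  show "lift h v = 0" if "v \<notin> V" for v using that by (simp add: lift_def)
  fix v assume v: "v \<in> V"
  have "L (lift h) v = L (\<lambda>y. h (\<pi> y)) v"
    by (rule laplacian_cong[OF v]) (simp add: lift_def)
  also have "\<dots> = - 2 * h (\<pi> v)"
    using laplacian_lift[OF v] B.eigenspace_eq[OF h, of "\<pi> v"] \<pi>_in[OF v] by (simp add: pverts_B)
  finally show "L (lift h) v = - 2 * lift h v" using v by (simp add: lift_def)
qed

text \<open>
  If \<open>g\<close> has no jump on the block at \<open>x0\<close>, it has none along the upward edges at any vertex of \<open>L0\<close>, because
  squares transport these jumps along the edges of the connected graph \<open>B\<close>.
\<close>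

lemma flat_on_block_imp_lift:
  assumes g: "g \<in> E" and w0: "w0 \<in> T" and flat: "g w0 = g x0"
  shows "\<exists>h\<in>B.E. g = lift h"
proof -
  define S where "S = {u \<in> L0. \<forall>w\<in>ups u. g w = g u}"
  have "S = pverts B"
  proof (rule B.closed_imp_all)
    show "S \<subseteq> pverts B" by (auto simp: S_def pverts_B)
    have "x0 \<in> S" using x0_L0 twins[OF g _ w0] flat by (auto simp: S_def ups_x0)
    then show "S \<noteq> {}" by auto
    fix u assume uS: "u \<in> S"
    then have u: "u \<in> L0" and fl: "\<And>w. w \<in> ups u \<Longrightarrow> g w = g u" by (auto simp: S_def)
    show "nbrs B u \<subseteq> S"
    proof
      fix y assume "y \<in> nbrs B u"
      then have y: "y \<in> N u - ups u" using nbrs_B[OF u] by simp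
      have "g z = g y" if z: "z \<in> ups y" for z
      proof -
        have "f z \<noteq> f u" using ups_f[OF z] L0_flat[OF u y] by simp
        then obtain w where w: "w \<in> ups u" "z = opposite u w y"
          using flat_step[OF u _ L0_flat[OF u y] ups_N[OF z]] y by blast
        have "y \<in> N u - {w}" using y w by auto
        then have "g z - g w = g y - g u"
          unfolding w(2) using L0_opposite_jump[OF u w(1) _ g] by blast
        then show ?thesis using fl[OF w(1)] by simp
      qed
      then show "y \<in> S" using flat_nbr_L0'[OF u y] by (simp add: S_def)
    qed
  qed
  then have fl: "g w = g u" if "u \<in> L0" "w \<in> ups u" for u w
    using that by (auto simp: S_def pverts_B)
  have g\<pi>: "g v = g (\<pi> v)" if v: "v \<in> V" for v
    using v
  proof (cases rule: verts_cases)
    case 1 then show ?thesis by simp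
  next
    case (2 u) then show ?thesis using fl \<pi>_L1 by simp
  next
    case (3 u w)
    obtain w' where w': "w' \<noteq> w" "ups u = {w, w'}" "v = opposite u w w'"
      by (rule nbrs_L2[OF 3]) blast
    have "w' \<in> N u - {w}" using w' ups_N by blast
    then have "g v - g w = g w' - g u"
      unfolding w'(3) using L0_opposite_jump[OF 3(1) 3(2) _ g] by blast
    then show ?thesis using fl[OF 3(1)] w'(2) \<pi>_L2[OF 3] by simp
  qed
  define h where "h = (\<lambda>u. if u \<in> L0 then g u else 0)"
  have gl: "g = lift h"
    using g\<pi> \<pi>_in eigenspace_outside[OF g] by (auto simp: lift_def h_def fun_eq_iff)
  have "h \<in> B.E"
  proof (rule B.eigenspaceI)
    show "h u = 0" if "u \<notin> pverts B" for u using that by (simp add: h_def pverts_B)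
    fix u assume "u \<in> pverts B"
    then have u: "u \<in> L0" by (simp add: pverts_B)
    have "laplacian B h u = L (\<lambda>y. h (\<pi> y)) u"
      using laplacian_lift[OF L0_V[OF u], of h] u by simp
    also have "\<dots> = L g u"
      by (rule laplacian_cong[OF L0_V[OF u]]) (simp add: gl lift_def)
    also have "\<dots> = - 2 * h u" using eigenspace_eq[OF g L0_V[OF u]] u by (simp add: h_def)
    finally show "laplacian B h u = - 2 * h u" .
  qed
  then show ?thesis using gl by blast
qed

lemma linear_lift: "Vector_Spaces.linear fun_scale fun_scale lift"
  unfolding Vector_Spaces.linear_iff using vector_space_fun_scale
  by (auto simp: lift_def fun_eq_iff fun_scale_def)

text \<open>
  The block has a single jump value for each \<open>g \<in> E\<close>, and subtracting a multiple of \<open>f\<close> makes it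
  vanish: modulo \<open>f\<close>, every function in \<open>E\<close> is a lift.
\<close>

lemma eigen_mult_B: "eigen_mult G 2 \<le> eigen_mult B 2 + 1"
proof -
  obtain A where A: "A \<subseteq> B.E" "B.E \<subseteq> fun_vs.span A" "card A = eigen_mult B 2"
    and finA: "finite A"
    by (rule B.finite_eigenbasis)
  obtain w0 where w0: "w0 \<in> T" using small by fastforce
  have "E \<subseteq> fun_vs.span (insert f (lift ` A))"
  proof
    fix g assume g: "g \<in> E"
    define c where "c = g w0 - g x0"
    have "f w0 - f x0 = 1" using f_x0 w0 T by auto
    then obtain h where h: "h \<in> B.E" "(\<lambda>y. g y + (- c) * f y) = lift h"
      using flat_on_block_imp_lift[OF eigenspace_add_scale[OF g f, of "- c"] w0]
      by (auto simp: c_def algebra_simps)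
    have "lift h \<in> fun_vs.span (lift ` A)"
      using fun_vs_pair.linear_span_image[OF linear_lift, of A] h(1) A(2) by auto
    then have "lift h \<in> fun_vs.span (insert f (lift ` A))"
      using fun_vs.span_mono[of "lift ` A" "insert f (lift ` A)"] by auto
    moreover have "g = lift h + fun_scale c f"
      unfolding h(2)[symmetric] by (auto simp: fun_scale_def fun_eq_iff)
    ultimately show "g \<in> fun_vs.span (insert f (lift ` A))"
      by (simp add: fun_vs.span_add fun_vs.span_scale fun_vs.span_base)
  qed
  then have "eigen_mult G 2 \<le> card (insert f (lift ` A))"
    unfolding eigen_mult_def by (rule fun_vs.dim_le_card) (simp add: finA)
  also have "\<dots> \<le> card A + 1"
    using card_insert_le_m1[of "card A + 1" "lift ` A" f] card_image_le[OF finA, of lift] by simp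
  finally show ?thesis using A(3) by simp
qed

text \<open>A lift has no jumps within the fibres, so a block of size one on \<open>B\<close> stays one on the graph.\<close>

lemma lift_unit_block:
  assumes unit: "B.twin_block u {w} h"
  shows "twin_block u {w} (lift h)"
proof -
  have u: "u \<in> L0" and w: "w \<in> nbrs B u" and h: "h \<in> B.E"
    and jump: "\<And>y. y \<in> nbrs B u \<Longrightarrow> h y - h u = (if y = w then 1 else 0)"
    using unit by (auto simp: B.twin_block_def pverts_B)
  have wN: "w \<in> N u - ups u" using w nbrs_B[OF u] by simp
  have "lift h y - lift h u = (if y = w then 1 else 0)" if y: "y \<in> N u" for y
  proof (cases "y \<in> ups u")
    case True
    then show ?thesis using wN \<pi>_L1[OF u True] u L0_V[OF u] nbrs_in_verts[OF y] by (auto simp: lift_def)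
  next
    case False
    then have "y \<in> nbrs B u" "y \<in> L0" using y nbrs_B[OF u] flat_nbr_L0'[OF u] by auto
    then show ?thesis using jump[of y] u L0_V by (auto simp: lift_def)
  qed
  then show ?thesis using L0_V[OF u] wN lift_in_E[OF h] by (auto simp: twin_block_def)
qed

end

section \<open>The spectrum of a sharp graph\<close>

context connected_regular_graph begin

lemma eigen_mult_pos_iff: "0 < eigen_mult G l \<longleftrightarrow> (\<exists>f\<in>eigenspace G l. f \<noteq> 0)"
proof -
  obtain A where A: "A \<subseteq> eigenspace G l" "fun_vs.independent A" "eigenspace G l \<subseteq> fun_vs.span A"
    "card A = eigen_mult G l" "finite A"
    by (rule finite_eigenbasis)
  show ?thesis
  proof
    assume "0 < eigen_mult G l"
    then obtain f where f: "f \<in> A" using A(4) by (metis card.empty equals0I less_numeral_extra(3))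
    then have "f \<noteq> 0" using A(2) fun_vs.dependent_zero by metis
    then show "\<exists>f\<in>eigenspace G l. f \<noteq> 0" using f A(1) by blast
  next
    assume "\<exists>f\<in>eigenspace G l. f \<noteq> 0"
    then have "A \<noteq> {}" using A(3) by auto
    then show "0 < eigen_mult G l" using A(4,5) card_gt_0_iff by metis
  qed
qed

lemma eigenspaces_orthogonal:
  assumes f: "f \<in> eigenspace G l" and g: "g \<in> eigenspace G l'" and ne: "l \<noteq> l'"
  shows "(\<Sum>x\<in>V. f x * g x) = 0"
proof -
  have "(\<Sum>x\<in>V. L f x * g x) = (\<Sum>x\<in>V. \<Sum>y\<in>N x. f y * g x) - real d * (\<Sum>x\<in>V. f x * g x)"
    by (simp add: laplacian_eq left_diff_distrib sum_subtractf sum_distrib_right sum_distrib_left mult.assoc)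
  also have "(\<Sum>x\<in>V. \<Sum>y\<in>N x. f y * g x) = (\<Sum>x\<in>V. \<Sum>y\<in>N x. f x * g y)"
    by (rule edge_sum_swap)
  also have "\<dots> - real d * (\<Sum>x\<in>V. f x * g x) = (\<Sum>x\<in>V. f x * L g x)"
    by (simp add: laplacian_eq right_diff_distrib sum_subtractf sum_distrib_left mult.left_commute)
  finally have "(\<Sum>x\<in>V. - l * (f x * g x)) = (\<Sum>x\<in>V. - l' * (f x * g x))"
    by (simp add: eigenspace_eq[OF f] eigenspace_eq[OF g] mult.assoc mult.left_commute)
  then have "l * (\<Sum>x\<in>V. f x * g x) = l' * (\<Sum>x\<in>V. f x * g x)"
    unfolding sum_distrib_left[symmetric] by simp
  then show ?thesis using ne by simp
qed

text \<open>
  Without finiteness the multiset sum defining the spectrum would be empty.  Eigenfunctions for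
  distinct eigenvalues are orthogonal, hence independent.
\<close>

lemma finite_eigenvalues: "finite {l. 0 < eigen_mult G l}"
proof -
  define \<Lambda> where "\<Lambda> = {l. 0 < eigen_mult G l}"
  obtain F where F: "\<And>l. l \<in> \<Lambda> \<Longrightarrow> F l \<in> eigenspace G l" "\<And>l. l \<in> \<Lambda> \<Longrightarrow> F l \<noteq> 0"
    using eigen_mult_pos_iff unfolding \<Lambda>_def by (metis mem_Collect_eq)
  have norm_pos: "(\<Sum>x\<in>V. F l x * F l x) \<noteq> 0" if l: "l \<in> \<Lambda>" for l
  proof
    assume "(\<Sum>x\<in>V. F l x * F l x) = 0"
    then have "\<forall>x\<in>V. F l x * F l x = 0"
      using finite_verts by (subst (asm) sum_nonneg_eq_0_iff) auto
    then have "F l x = 0" for x using eigenspace_outside[OF F(1)[OF l], of x] by (cases "x \<in> V") auto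
    then show False using F(2)[OF l] by (auto simp: fun_eq_iff)
  qed
  have orth: "(\<Sum>x\<in>V. F l x * F l' x) = 0" if "l \<in> \<Lambda>" "l' \<in> \<Lambda>" "l \<noteq> l'" for l l'
    by (rule eigenspaces_orthogonal[OF F(1) F(1)]) (use that in auto)
  have inj: "inj_on F \<Lambda>"
  proof (rule inj_onI, rule ccontr)
    fix l l' assume l: "l \<in> \<Lambda>" "l' \<in> \<Lambda>" "F l = F l'" "l \<noteq> l'"
    then show False using orth[of l l'] norm_pos[of l] by simp
  qed
  have ind: "fun_vs.independent (F ` \<Lambda>)"
    unfolding fun_vs.independent_explicit_finite_subsets
  proof (intro allI impI ballI)
    fix S u v assume S: "S \<subseteq> F ` \<Lambda>" "finite S" and zero: "(\<Sum>v\<in>S. fun_scale (u v) v) = 0" and v: "v \<in> S"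
    obtain l where l: "l \<in> \<Lambda>" "v = F l" using S v by auto
    have "0 = (\<Sum>x\<in>V. (\<Sum>w\<in>S. fun_scale (u w) w) x * v x)" by (simp add: zero)
    also have "\<dots> = (\<Sum>w\<in>S. u w * (\<Sum>x\<in>V. w x * v x))"
      unfolding sum_fun_apply sum_distrib_right sum_distrib_left
      by (subst sum.swap) (simp add: fun_scale_def mult.assoc)
    also have "\<dots> = (\<Sum>w\<in>S. if w = v then u v * (\<Sum>x\<in>V. v x * v x) else 0)"
      by (intro sum.cong refl) (use S l orth in force)
    also have "\<dots> = u v * (\<Sum>x\<in>V. v x * v x)" using S(2) v by simp
    finally show "u v = 0" using norm_pos[OF l(1)] l(2) by simp
  qed
  have "F ` \<Lambda> \<subseteq> fun_vs.span (point_mass ` V)"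
    using F(1) eigenspace_outside by (auto intro!: supported_in_span finite_verts)
  then have "finite (F ` \<Lambda>)"
    using fun_vs.independent_span_bound[OF _ ind, of "point_mass ` V"] finite_verts by auto
  then show ?thesis using finite_imageD[OF _ inj] unfolding \<Lambda>_def by blast
qed

lemma constant_eigenfunction: "0 < eigen_mult G 0"
proof -
  have "(\<lambda>x. if x \<in> V then 1 else 0) \<in> eigenspace G 0"
    using nbrs_in_verts by (intro eigenspaceI) (auto simp: laplacian_nbrs intro!: sum.neutral)
  moreover have "(\<lambda>x. if x \<in> V then 1 else 0 :: real) \<noteq> 0"
    using verts_nonempty by (auto simp: fun_eq_iff)
  ultimately show ?thesis using eigen_mult_pos_iff by blast
qed

lemma set_spectrum: "set_mset (spectrum_mset G) = {l. 0 < eigen_mult G l}"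
  unfolding spectrum_mset_def by (simp add: set_mset_sum[OF finite_eigenvalues])

text \<open>
  The eigenvalues 0 and 2 ensure that the sorted spectrum has at least two entries, so that the
  indexing in \<^const>\<open>laplacian_eigenvalue\<close> is meaningful.
\<close>

lemma first_eigenvalue_pos_mult:
  assumes two: "0 < eigen_mult G 2"
  shows "0 < eigen_mult G (laplacian_eigenvalue G 1)"
proof -
  let ?xs = "sorted_list_of_multiset (spectrum_mset G)"
  have set: "set ?xs = {l. 0 < eigen_mult G l}" using set_spectrum by simp
  have "{0, 2} \<subseteq> set ?xs" using set two constant_eigenfunction by auto
  then have "card {0, 2 :: real} \<le> card (set ?xs)" by (intro card_mono) auto
  also have "\<dots> \<le> length ?xs" by (rule card_length)
  finally have "1 < length ?xs" by simp
  then have "?xs ! 1 \<in> set ?xs" by (rule nth_mem)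
  then show ?thesis using set by (simp add: laplacian_eigenvalue_def)
qed

lemma lichnerowicz_sharp_CD2:
  assumes sharp: "lichnerowicz_sharp G" and two: "0 < eigen_mult G 2"
  shows "CD_inf G 2"
proof -
  obtain K where K: "K > 0" "CD_inf G K" "laplacian_eigenvalue G 1 = K"
    using sharp by (auto simp: lichnerowicz_sharp_def)
  obtain f where f: "f \<in> eigenspace G K" "f \<noteq> 0"
    using first_eigenvalue_pos_mult[OF two] K(3) eigen_mult_pos_iff by auto
  then obtain x where x: "f x \<noteq> 0" by (auto simp: fun_eq_iff)
  then have "x \<in> V" using eigenspace_outside[OF f(1)] by blast
  then have "K = 2" using sharp_eigenvalue[OF K(2) f(1) _ x] K(1) by auto
  then show ?thesis using K(2) by simp
qed

section \<open>Connected regular graphs as pair graphs\<close>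

lemma pair_graph_G: "pair_graph G"
proof
  have sub: "parcs G \<subseteq> V \<times> V"
    using nbrs_dom nbrs_subset by (auto simp: nbrs_def)
  show "finite (pverts G)" by (rule finite_verts)
  show "finite (parcs G)" using finite_subset[OF sub] finite_verts by auto
  show "fst e \<in> V" "snd e \<in> V" if "e \<in> parcs G" for e using sub that by auto
  show "fst e \<noteq> snd e" if "e \<in> parcs G" for e
    using that nbrs_irrefl by (cases e) (auto simp: nbrs_def)
  show "symmetric (with_proj G)"
    unfolding symmetric_def with_proj_simps using nbrs_sym by (auto simp: nbrs_def intro: symI)
qed

lemma regular_G: "regular_graph d G"
proof -
  have "out_arcs (with_proj G) x = Pair x ` N x" for x
    by (auto simp: out_arcs_def nbrs_def)
  then have "out_degree (with_proj G) x = card (N x)" for x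
    unfolding out_degree_def by (simp add: card_image inj_on_def)
  then show ?thesis by (simp add: regular_graph_def card_nbrs)
qed

lemma connected_G: "Digraph_Component.connected (with_proj G)"
  unfolding connected_conv with_proj_simps
proof (intro conjI ballI)
  show "V \<noteq> {}" by (rule verts_nonempty)
  fix u v assume u: "u \<in> V" and v: "v \<in> V"
  let ?R = "rtrancl_on V ((parcs G)\<^sup>s)"
  have "{v \<in> V. (u, v) \<in> ?R} = V"
  proof (rule closed_imp_all)
    show "{v \<in> V. (u, v) \<in> ?R} \<noteq> {}" using u by auto
    fix x assume x: "x \<in> {v \<in> V. (u, v) \<in> ?R}"
    show "N x \<subseteq> {v \<in> V. (u, v) \<in> ?R}"
    proof
      fix y assume y: "y \<in> N x"
      then have "(x, y) \<in> (parcs G)\<^sup>s" by (simp add: nbrs_def symcl_def)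
      then have "(u, y) \<in> ?R"
        using x nbrs_in_verts[OF y] by (auto intro: rtrancl_on_into_rtrancl_on)
      then show "y \<in> {v \<in> V. (u, v) \<in> ?R}" using nbrs_in_verts[OF y] by simp
    qed
  qed auto
  then show "(u, v) \<in> ?R" using v by blast
qed

end

lemma connected_regular_graphI:
  assumes "pair_graph G" and conn: "Digraph_Component.connected (with_proj G)" and reg: "regular_graph d G"
  shows "connected_regular_graph G d"
proof -
  interpret pair_graph G by fact
  have arc: "x \<in> pverts G" "y \<in> pverts G" if "y \<in> nbrs G x" for x y
    using that in_arcsD1 in_arcsD2 by (auto simp: nbrs_def)
  have symm: "x \<in> nbrs G y" if "y \<in> nbrs G x" for x y
    using that pair_sym_arcs unfolding symmetric_def with_proj_simps by (auto simp: nbrs_def dest: symD)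
  show ?thesis
  proof
    show "finite (pverts G)" by (rule pair_finite_verts)
    show "pverts G \<noteq> {}" using conn unfolding connected_conv by simp
    show "nbrs G x \<subseteq> pverts G" for x using arc by auto
    show "y \<in> nbrs G x \<Longrightarrow> x \<in> pverts G" for x y using arc by auto
    show "y \<in> nbrs G x \<Longrightarrow> x \<in> nbrs G y" for x y by (rule symm)
    show "x \<notin> nbrs G x" for x using pair_no_loops by (force simp: nbrs_def)
    have "out_arcs (with_proj G) x = Pair x ` nbrs G x" for x
      by (auto simp: Digraph.out_arcs_def nbrs_def)
    then have "out_degree (with_proj G) x = card (nbrs G x)" for x
      unfolding Digraph.out_degree_def by (simp add: card_image inj_on_def)
    then show "x \<in> pverts G \<Longrightarrow> card (nbrs G x) = d" for x
      using reg by (simp add: regular_graph_def)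
    fix S assume S: "S \<subseteq> pverts G" "S \<noteq> {}" and closed: "\<And>x. x \<in> S \<Longrightarrow> nbrs G x \<subseteq> S"
    obtain s where s: "s \<in> S" using S by auto
    have "v \<in> S" if v: "v \<in> pverts G" for v
    proof -
      have "(s, v) \<in> rtrancl_on (pverts G) ((parcs G)\<^sup>s)"
        using conn s S v unfolding connected_conv with_proj_simps by blast
      then show ?thesis
      proof (induction rule: rtrancl_on_induct)
        case base show ?case by (rule s)
      next
        case (step y z)
        then have "z \<in> nbrs G y \<or> y \<in> nbrs G z" by (auto simp: symcl_def nbrs_def)
        then have "z \<in> nbrs G y" using symm by blast
        then show ?case using closed step by blast
      qed
    qed
    then show "S = pverts G" using S by auto
  qed
qed

section \<open>Splitting off hypercube factors\<close>

text \<open>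
  An isomorphism of pair graphs as a map of vertices, which is easier to compose with a change of
  coordinates in the hypercube than the record of vertex and arc maps behind \<^const>\<open>digraph_iso\<close>.
\<close>

definition graph_iso :: "('a \<Rightarrow> 'b) \<Rightarrow> 'a pair_pre_digraph \<Rightarrow> 'b pair_pre_digraph \<Rightarrow> bool" where
  "graph_iso h G H \<longleftrightarrow> bij_betw h (pverts G) (pverts H)
     \<and> (\<forall>u\<in>pverts G. \<forall>v\<in>pverts G. (u, v) \<in> parcs G \<longleftrightarrow> (h u, h v) \<in> parcs H)"

lemma graph_iso_imp_digraph_iso:
  assumes G: "pair_graph G" and H: "parcs H \<subseteq> pverts H \<times> pverts H" and iso: "graph_iso h G H"
  shows "digraph_iso (with_proj G) (with_proj H)"
proof -
  interpret pair_graph G by fact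
  have bij: "h ` pverts G = pverts H" "inj_on h (pverts G)"
    using iso by (auto simp: graph_iso_def bij_betw_def)
  have arcs: "(u, v) \<in> parcs G \<longleftrightarrow> (h u, h v) \<in> parcs H" if "u \<in> pverts G" "v \<in> pverts G" for u v
    using iso that by (auto simp: graph_iso_def)
  define \<Phi> where "\<Phi> = \<lparr>iso_verts = h, iso_arcs = map_prod h h, iso_head = snd, iso_tail = fst\<rparr>"
  have sub: "parcs G \<subseteq> pverts G \<times> pverts G" using in_arcsD1 in_arcsD2 by auto
  have "inj_on (map_prod h h) (parcs G)"
    by (rule inj_on_subset[OF map_prod_inj_on[OF bij(2) bij(2)] sub])
  then have "pre_digraph.digraph_isomorphism (with_proj G) \<Phi>"
    unfolding pre_digraph.digraph_isomorphism_def \<Phi>_def using bij(2) wf_digraph by auto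
  moreover have "map_prod h h ` parcs G = parcs H"
  proof
    show "map_prod h h ` parcs G \<subseteq> parcs H" using arcs sub by auto
    show "parcs H \<subseteq> map_prod h h ` parcs G"
    proof
      fix e assume e: "e \<in> parcs H"
      obtain p q where pq: "e = (p, q)" by (cases e)
      then have "p \<in> h ` pverts G" "q \<in> h ` pverts G" using e H bij(1) by auto
      then obtain a b where ab: "e = (h a, h b)" "a \<in> pverts G" "b \<in> pverts G"
        using pq by blast
      then have "(a, b) \<in> parcs G" using arcs e by simp
      then show "e \<in> map_prod h h ` parcs G" using ab(1) by force
    qed
  qed
  then have "with_proj H = app_iso \<Phi> (with_proj G)"
    by (simp add: app_iso_def \<Phi>_def with_proj_def bij(1))
  ultimately show ?thesis unfolding digraph_iso_def by blast
qed

lemma hypercube_0: "pverts (hypercube 0) = {\<lambda>_. undefined}" "parcs (hypercube 0) = {}"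
  by (auto simp: hypercube_def)

lemma graph_iso_hypercube_0:
  assumes "parcs G \<subseteq> pverts G \<times> pverts G"
  shows "graph_iso (\<lambda>v. (v, \<lambda>_. undefined)) G (cartesian_product G (hypercube 0))"
  using assms by (auto simp: graph_iso_def cartesian_product_def hypercube_0 bij_betw_def inj_on_def)

lemma hypercube_edge_Suc:
  assumes "x \<in> pverts (hypercube n)" "y \<in> pverts (hypercube n)"
  shows "(x(n := a), y(n := b)) \<in> parcs (hypercube (Suc n))
    \<longleftrightarrow> x = y \<and> a \<noteq> b \<or> a = b \<and> (x, y) \<in> parcs (hypercube n)"
proof -
  have xy: "x \<in> {..<n} \<rightarrow>\<^sub>E UNIV" "y \<in> {..<n} \<rightarrow>\<^sub>E UNIV"
    using assms by (simp_all add: hypercube_def)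
  have upd: "z(n := c) \<in> {..<Suc n} \<rightarrow>\<^sub>E UNIV" if "z \<in> {..<n} \<rightarrow>\<^sub>E UNIV" for z :: "nat \<Rightarrow> bit" and c
    using that by (auto simp: PiE_iff extensional_def)
  have eq: "x = y \<longleftrightarrow> (\<forall>i<n. x i = y i)"
    using xy by (auto intro: PiE_ext)
  have "(\<exists>!i. i < Suc n \<and> (x(n := a)) i \<noteq> (y(n := b)) i)
      \<longleftrightarrow> (\<forall>i<n. x i = y i) \<and> a \<noteq> b \<or> a = b \<and> (\<exists>!i. i < n \<and> x i \<noteq> y i)"
  proof (cases "a = b")
    case True
    have "(i < Suc n \<and> (x(n := a)) i \<noteq> (y(n := b)) i) \<longleftrightarrow> (i < n \<and> x i \<noteq> y i)" for i
      using True by (cases "i = n") (simp_all add: less_Suc_eq)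
    then show ?thesis using True by simp
  next
    case False
    have "(i < Suc n \<and> (x(n := a)) i \<noteq> (y(n := b)) i) \<longleftrightarrow> (i = n \<or> i < n \<and> x i \<noteq> y i)" for i
      using False by (cases "i = n") (simp_all add: less_Suc_eq)
    then have "(\<exists>!i. i < Suc n \<and> (x(n := a)) i \<noteq> (y(n := b)) i)
        \<longleftrightarrow> (\<exists>!i. i = n \<or> i < n \<and> x i \<noteq> y i)" by simp
    also have "\<dots> \<longleftrightarrow> (\<forall>i<n. x i = y i)" by (metis less_irrefl)
    finally show ?thesis using False by blast
  qed
  then show ?thesis using xy upd[OF xy(1)] upd[OF xy(2)] eq by (simp add: hypercube_def)
qed

context twin_fibration begin

context
  assumes unit: "card T = 1"
begin

lemma ups_single:
  assumes u: "u \<in> L0" and w: "w \<in> ups u"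
  shows "ups u = {w}"
proof -
  have "card (ups u) = 1" using L0_card[OF u] unit by simp
  then obtain z where "ups u = {z}" by (rule card_1_singletonE)
  then show ?thesis using w by simp
qed

lemma unit_verts_cases:
  assumes "v \<in> V"
  obtains "v \<in> L0" | u where "u \<in> L0" "v \<in> ups u"
  using assms
proof (cases rule: verts_cases)
  case (3 u w)
  have "r = 2" by (rule nbrs_L2[OF 3])
  then show ?thesis using unit by (simp add: r_def)
qed (use that in blast)+

lemma unit_level:
  assumes "v \<in> V"
  shows "(f v < 0 \<longleftrightarrow> v \<in> L0)" "f v = - 1 / 2 \<or> f v = 1 / 2"
proof -
  have r1: "r = 1" by (simp add: r_def unit)
  show "(f v < 0 \<longleftrightarrow> v \<in> L0)" "f v = - 1 / 2 \<or> f v = 1 / 2"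
    using assms by (cases rule: unit_verts_cases; use L0_f ups_f r1 in force)+
qed

lemma unit_inj:
  assumes u: "u \<in> V" and v: "v \<in> V" and eq: "\<pi> u = \<pi> v" "f u = f v"
  shows "u = v"
  using u
proof (cases rule: unit_verts_cases)
  case 1
  then have "v \<in> L0" using unit_level(1)[OF u] unit_level(1)[OF v] eq by simp
  then show ?thesis using 1 eq by simp
next
  case (2 a)
  have "v \<notin> L0" using unit_level(1)[OF u] unit_level(1)[OF v] eq L0_f[OF 2(1)] ups_f[OF 2(2)] unit by (simp add: r_def)
  then obtain b where b: "b \<in> L0" "v \<in> ups b" using unit_verts_cases[OF v] by blast
  then have "a = b" using eq \<pi>_L1 2 by simp
  then show ?thesis using ups_single[OF 2] b by auto
qed

text \<open>
  The coordinates \<open>\<pi>\<close> and \<open>f\<close> exhibit the graph as the product of \<open>B\<close> with an edge.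
\<close>

lemma unit_edge:
  assumes u: "u \<in> V" and v: "v \<in> V"
  shows "v \<in> N u \<longleftrightarrow> \<pi> u = \<pi> v \<and> f u \<noteq> f v \<or> f u = f v \<and> \<pi> v \<in> nbrs B (\<pi> u)"
proof
  assume e: "v \<in> N u"
  from u show "\<pi> u = \<pi> v \<and> f u \<noteq> f v \<or> f u = f v \<and> \<pi> v \<in> nbrs B (\<pi> u)"
  proof (cases rule: unit_verts_cases)
    case 1
    show ?thesis
    proof (cases "v \<in> ups u")
      case True then show ?thesis using \<pi>_L1[OF 1 True] 1 ups_f[OF True] by simp
    next
      case False
      then have "v \<in> N u - ups u" using e by simp
      then show ?thesis using 1 L0_flat[OF 1] nbrs_B[OF 1] flat_nbr_L0'[OF 1] by simp
    qed
  next
    case (2 a)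
    show ?thesis
    proof (rule nbrs_L1[OF 2 e])
      assume "v = a" then show ?thesis using 2 \<pi>_L1[OF 2] ups_f[OF 2(2)] by simp
    next
      fix y assume "y \<in> ups a - {u}" then show ?thesis using ups_single[OF 2] by simp
    next
      fix y assume y: "y \<in> N a - ups a" "y \<in> L0" "f v = f u" "v \<in> ups y"
      then show ?thesis using \<pi>_L1[OF 2] \<pi>_L1[OF y(2,4)] nbrs_B[OF 2(1)] by simp
    qed
  qed
next
  assume "\<pi> u = \<pi> v \<and> f u \<noteq> f v \<or> f u = f v \<and> \<pi> v \<in> nbrs B (\<pi> u)"
  then show "v \<in> N u"
  proof (elim disjE conjE)
    assume eq: "\<pi> u = \<pi> v" "f u \<noteq> f v"
    have near: "x = \<pi> x \<or> x \<in> ups (\<pi> x)" if "x \<in> V" for x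
      using that by (cases rule: unit_verts_cases) (use \<pi>_L1 in auto)
    define a where "a = \<pi> v"
    have a: "a \<in> L0" using \<pi>_in[OF v] by (simp add: a_def)
    have "u = a \<or> u \<in> ups a" "v = a \<or> v \<in> ups a" using near[OF u] near[OF v] eq by (simp_all add: a_def)
    moreover have "f u = f v" if "u \<in> ups a" "v \<in> ups a" using ups_f[OF that(1)] ups_f[OF that(2)] by simp
    ultimately have "u = a \<and> v \<in> ups a \<or> v = a \<and> u \<in> ups a" using eq(2) by auto
    then show ?thesis using ups_N nbrs_sym by blast
  next
    assume eq: "f u = f v" and nb: "\<pi> v \<in> nbrs B (\<pi> u)"
    from u show ?thesis
    proof (cases rule: unit_verts_cases)
      case 1
      then have "v \<in> L0" using unit_level(1)[OF u] unit_level(1)[OF v] eq by simp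
      then show ?thesis using nb 1 nbrs_B[OF 1] by simp
    next
      case (2 a)
      have "v \<notin> L0"
        using unit_level(1)[OF u] unit_level(1)[OF v] eq L0_f[OF 2(1)] ups_f[OF 2(2)] unit by (simp add: r_def)
      then obtain b where b: "b \<in> L0" "v \<in> ups b" using unit_verts_cases[OF v] by blast
      have ba: "b \<in> N a - ups a" using nb \<pi>_L1[OF 2] \<pi>_L1[OF b] nbrs_B[OF 2(1)] by simp
      then have y: "b \<in> N a - {u}" using 2 by auto
      have "f (opposite a u b) = f b + 1"
        using L0_opposite_jump[OF 2 y f] ups_f[OF 2(2)] L0_flat[OF 2(1) ba] by simp
      then have "opposite a u b \<in> ups b" using L0_opposite_props(2)[OF 2 y] by (simp add: ups_def)
      then have "opposite a u b = v" using ups_single[OF b] by simp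
      then show ?thesis using L0_opposite_props(1)[OF 2 y] by simp
    qed
  qed
qed

text \<open>The sign of \<open>f\<close> becomes the new coordinate of the hypercube.\<close>

lemma graph_iso_unit_step:
  assumes iso: "graph_iso h B (cartesian_product A (hypercube n))"
  shows "graph_iso (\<lambda>v. (fst (h (\<pi> v)), (snd (h (\<pi> v)))(n := if f v < 0 then 0 else 1)))
    G (cartesian_product A (hypercube (Suc n)))" (is "graph_iso ?h _ _")
proof -
  have bij: "bij_betw h L0 (pverts A \<times> pverts (hypercube n))"
    and edge: "\<And>u v. u \<in> L0 \<Longrightarrow> v \<in> L0 \<Longrightarrow> (u, v) \<in> parcs B \<longleftrightarrow> (h u, h v) \<in> parcs (cartesian_product A (hypercube n))"
    using iso by (auto simp: graph_iso_def pverts_B cartesian_product_def)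
  have hV: "fst (h (\<pi> v)) \<in> pverts A" "snd (h (\<pi> v)) \<in> pverts (hypercube n)" if "v \<in> V" for v
    using bij_betwE[OF bij] \<pi>_in[OF that] by (metis mem_Times_iff)+
  have upd_in: "x(n := c) \<in> pverts (hypercube (Suc n))" if "x \<in> pverts (hypercube n)" for x c
    using that by (auto simp: hypercube_def PiE_iff extensional_def)
  have upd_eq: "x = y \<and> a = b" if "x(n := a) = y(n := b)" "x \<in> pverts (hypercube n)" "y \<in> pverts (hypercube n)"
    for x y and a b :: bit
  proof -
    have "x n = undefined" "y n = undefined" using that by (auto simp: hypercube_def PiE_iff extensional_def)
    then show ?thesis using that(1) by (metis fun_upd_same fun_upd_triv fun_upd_upd)
  qed
  have sgn: "(if f u < 0 then 0 else 1) = ((if f v < 0 then 0 else 1) :: bit) \<longleftrightarrow> f u = f v"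
    if "u \<in> V" "v \<in> V" for u v
    using unit_level(2)[OF that(1)] unit_level(2)[OF that(2)] by auto
  have h_eq: "h (\<pi> u) = h (\<pi> v) \<longleftrightarrow> \<pi> u = \<pi> v" if "u \<in> V" "v \<in> V" for u v
    by (rule inj_on_eq_iff[OF bij_betw_imp_inj_on[OF bij] \<pi>_in[OF that(1)] \<pi>_in[OF that(2)]])
  have inj: "inj_on ?h V"
  proof (rule inj_onI)
    fix u v assume u: "u \<in> V" and v: "v \<in> V" and eq: "?h u = ?h v"
    then have "snd (h (\<pi> u)) = snd (h (\<pi> v)) \<and> (if f u < 0 then 0 else 1) = ((if f v < 0 then 0 else 1) :: bit)"
      by (intro upd_eq hV) auto
    then have "h (\<pi> u) = h (\<pi> v)" "f u = f v" using eq sgn[OF u v] by (auto simp: prod_eq_iff)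
    then show "u = v" using unit_inj[OF u v] h_eq[OF u v] by simp
  qed
  have surj: "\<exists>v\<in>V. p = ?h v" if p: "p \<in> pverts A \<times> pverts (hypercube (Suc n))" for p
  proof -
    obtain b x where bx: "p = (b, x)" "b \<in> pverts A" "x \<in> {..<Suc n} \<rightarrow>\<^sub>E UNIV"
      using p by (auto simp: hypercube_def)
    then have "x(n := undefined) \<in> pverts (hypercube n)"
      by (auto simp: hypercube_def PiE_iff extensional_def)
    then have "(b, x(n := undefined)) \<in> h ` L0" using bij bx(2) by (simp add: bij_betw_def)
    then obtain u where u: "u \<in> L0" "h u = (b, x(n := undefined))" by (metis imageE)
    obtain w where w: "w \<in> ups u" using L0_card[OF u(1)] unit by (metis card_1_singletonE insertI1)
    have uV: "u \<in> V" and wV: "w \<in> V" using L0_V u(1) nbrs_in_verts ups_N w by blast+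
    have "w \<notin> L0" using L0_f[OF u(1)] L0_f[of w] ups_f[OF w] by auto
    then have "f u < 0" "\<not> f w < 0" using unit_level(1) u(1) uV wV by auto
    then have "?h u = (b, x(n := 0))" "?h w = (b, x(n := 1))"
      using u \<pi>_L1[OF u(1) w] by simp_all
    moreover have "x = x(n := 0) \<or> x = x(n := 1)"
      by (cases "x n") (metis fun_upd_triv)+
    ultimately have "p = ?h u \<or> p = ?h w" using bx(1) by metis
    then show ?thesis using uV wV by blast
  qed
  have "bij_betw ?h V (pverts A \<times> pverts (hypercube (Suc n)))"
    unfolding bij_betw_def
  proof (intro conjI inj equalityI subsetI)
    show "p \<in> pverts A \<times> pverts (hypercube (Suc n))" if "p \<in> ?h ` V" for p
      using that hV upd_in by auto
    show "p \<in> ?h ` V" if "p \<in> pverts A \<times> pverts (hypercube (Suc n))" for p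
      using surj[OF that] by blast
  qed
  moreover have "(u, v) \<in> parcs G \<longleftrightarrow> (?h u, ?h v) \<in> parcs (cartesian_product A (hypercube (Suc n)))"
    if u: "u \<in> V" and v: "v \<in> V" for u v
  proof -
    obtain b x where bx: "h (\<pi> u) = (b, x)" by (cases "h (\<pi> u)")
    obtain c y where cy: "h (\<pi> v) = (c, y)" by (cases "h (\<pi> v)")
    define s :: bit where "s = (if f u < 0 then 0 else 1)"
    define t :: bit where "t = (if f v < 0 then 0 else 1)"
    have mem: "b \<in> pverts A" "c \<in> pverts A" "x \<in> pverts (hypercube n)" "y \<in> pverts (hypercube n)"
      using hV[OF u] hV[OF v] bx cy by auto
    have st: "s = t \<longleftrightarrow> f u = f v" unfolding s_def t_def by (rule sgn[OF u v])
    have upd: "x(n := s) = y(n := t) \<longleftrightarrow> x = y \<and> s = t" using upd_eq mem by blast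
    have "(u, v) \<in> parcs G \<longleftrightarrow> v \<in> N u" by (simp add: nbrs_def)
    also have "\<dots> \<longleftrightarrow> h (\<pi> u) = h (\<pi> v) \<and> f u \<noteq> f v \<or> f u = f v \<and> (\<pi> u, \<pi> v) \<in> parcs B"
      unfolding unit_edge[OF u v] h_eq[OF u v] by (simp add: nbrs_def[of B])
    also have "\<dots> \<longleftrightarrow> b = c \<and> x = y \<and> s \<noteq> t
        \<or> s = t \<and> (b = c \<and> (x, y) \<in> parcs (hypercube n) \<or> (b, c) \<in> parcs A \<and> x = y)"
      unfolding edge[OF \<pi>_in[OF u] \<pi>_in[OF v]] bx cy using mem st by (auto simp: cartesian_product_def)
    also have "\<dots> \<longleftrightarrow> b = c \<and> (x(n := s), y(n := t)) \<in> parcs (hypercube (Suc n))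
        \<or> (b, c) \<in> parcs A \<and> x(n := s) = y(n := t)"
      unfolding hypercube_edge_Suc[OF mem(3,4)] upd by auto
    also have "\<dots> \<longleftrightarrow> ((b, x(n := s)), (c, y(n := t))) \<in> parcs (cartesian_product A (hypercube (Suc n)))"
      using mem upd_in by (auto simp: cartesian_product_def)
    finally show ?thesis by (simp add: bx cy s_def t_def)
  qed
  ultimately show ?thesis by (simp add: graph_iso_def cartesian_product_def)
qed

end

end

context cd2_graph begin

text \<open>
  In degree two the neighbours \<open>w\<close> and \<open>w'\<close> of \<open>x\<close> have the same neighbours, so the difference of their
  indicator functions lies in \<open>E\<close> and tells them apart.
\<close>

lemma no_twin_pair_in_4_cycle:
  assumes block: "twin_block x T f" and pair: "card T = 2" and d: "d = 2"
  shows False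
proof -
  interpret twin_fibration G d x T f by unfold_locales (rule block, simp add: pair)
  obtain w w' where w: "T = {w, w'}" "w \<noteq> w'" using pair unfolding card_2_iff by blast
  have ge: "f x \<le> f y" if "y \<in> N x" for y using L0_ge[OF x0_L0 that] .
  have up: "w \<in> ups x" "w' \<in> ups x" by (simp_all only: ups_x0 w(1) insert_iff simp_thms)
  have wV: "w \<in> V" "w' \<in> V" using nbrs_in_verts[OF ups_N[OF up(1)]] nbrs_in_verts[OF ups_N[OF up(2)]] .
  have "card (N w \<inter> N w') = 2"
  proof (rule unique_square[OF x0 ups_N[OF up(1)]])
    show "N x \<inter> N w = {}"
      by (rule local_min_no_triangle[OF f x0 ge ups_N[OF up(1)] ups_gt[OF up(1)]])
    show "codeg x z = 2" if "z \<in> N w - {x}" for z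
      by (rule local_min_codeg[OF f x0 ge ups_N[OF up(1)] ups_gt[OF up(1)] that])
    show "w' \<in> N x" by (rule ups_N[OF up(2)])
    show "w' \<noteq> w" using w(2) by simp
  qed
  then have "card (N w \<inter> N w') = card (N w)" "card (N w \<inter> N w') = card (N w')"
    using card_nbrs[OF wV(1)] card_nbrs[OF wV(2)] d by simp_all
  then have "N w \<inter> N w' = N w" "N w \<inter> N w' = N w'"
    using card_subset_eq[OF finite_nbrs Int_lower1] card_subset_eq[OF finite_nbrs Int_lower2] by blast+
  then have same: "N w = N w'" by simp
  define h :: "'a \<Rightarrow> real" where "h v = (if v = w then 1 else if v = w' then - 1 else 0)" for v
  have "h \<in> E"
  proof (rule eigenspaceI)
    show "h v = 0" if "v \<notin> V" for v using that wV by (auto simp: h_def)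
    fix v assume v: "v \<in> V"
    have "(\<Sum>y\<in>N v. h y) = (\<Sum>y\<in>N v. (if y = w then 1 else 0) - (if y = w' then 1 else 0))"
      by (intro sum.cong refl) (use w(2) in \<open>auto simp: h_def\<close>)
    also have "\<dots> = (if w \<in> N v then 1 else 0) - (if w' \<in> N v then 1 else 0)"
      by (simp add: sum_subtractf)
    also have "\<dots> = 0"
    proof -
      have "w \<in> N v \<longleftrightarrow> w' \<in> N v" using same nbrs_sym by blast
      then show ?thesis by simp
    qed
    finally show "L h v = - 2 * h v" using laplacian_eq[OF v, of h] d by simp
  qed
  then have "h w = h w'" using twins[of h w w'] w by simp
  then show False using w(2) by (simp add: h_def)
qed

end

text \<open>
  Passing from a block of size two to \<open>B\<close> lowers the degree by two and the multiplicity by at most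
  one, which preserves \<open>d \<le> 2 dim E\<close>.  The induction would break down only at degree zero, that is, for
  a block of size two in degree two.
\<close>

lemma ex_unit_block:
  assumes "cd2_graph G d" "0 < d" "d \<le> 2 * eigen_mult G 2"
  shows "\<exists>x w f. cd2_graph.twin_block G x {w} f"
  using assms
proof (induction d arbitrary: G rule: less_induct)
  case (less d)
  interpret cd2_graph G d by (rule less.prems)
  obtain x T f where block: "twin_block x T f" and small: "card T = 1 \<or> card T = 2"
    using ex_small_twin_block less.prems by blast
  show ?case
  proof (cases "card T = 1")
    case True
    then obtain w where "T = {w}" by (rule card_1_singletonE)
    then show ?thesis using block by blast
  next
    case False
    then have T2: "card T = 2" using small by simp
    interpret twin_fibration G d x T f by unfold_locales (use block small in auto)
    have "d \<noteq> 2" using no_twin_pair_in_4_cycle[OF block T2] by blast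
    moreover have "2 \<le> d" using card_nbrs_B(2)[OF x0_L0] T2 by simp
    ultimately have d: "0 < d - 2" "d - 2 < d" by auto
    have "cd2_graph B (d - 2)" using B.cd2_graph_axioms T2 by simp
    moreover have "d - 2 \<le> 2 * eigen_mult B 2" using eigen_mult_B less.prems(3) by linarith
    ultimately obtain u w h where "B.twin_block u {w} h" using less.IH[OF d(2) _ d(1)] by blast
    then show ?thesis using lift_unit_block by blast
  qed
qed

text \<open>
  The degree is \<open>d = 2 m - 1 + n\<close>, and the bound on the multiplicity is \<open>d - m\<close>.  While \<open>n > 0\<close> it is at least
  \<open>d / 2\<close>, so a block of size one exists; splitting it off lowers \<open>n\<close> by one and keeps \<open>m\<close>.
\<close>

lemma hypercube_factor:
  assumes "cd2_graph G (2 * m - 1 + n)" "0 < m" "m - 1 + n \<le> eigen_mult G 2"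
  shows "\<exists>B h. cd2_graph (B :: 'a pair_pre_digraph) (2 * m - 1) \<and> m - 1 \<le> eigen_mult B 2
    \<and> graph_iso h (G :: 'a pair_pre_digraph) (cartesian_product B (hypercube n))"
  using assms
proof (induction n arbitrary: G)
  case 0
  interpret cd2_graph G "2 * m - 1" using "0.prems" by simp
  have "parcs G \<subseteq> pverts G \<times> pverts G"
    using nbrs_dom nbrs_subset by (auto simp: nbrs_def)
  then show ?case using graph_iso_hypercube_0[of G] "0.prems" cd2_graph_axioms by auto
next
  case (Suc n)
  interpret cd2_graph G "2 * m - 1 + Suc n" by (rule Suc.prems)
  have "2 * m - 1 + Suc n \<le> 2 * eigen_mult G 2" using Suc.prems(2,3) by linarith
  then obtain x w f where block: "twin_block x {w} f"
    using ex_unit_block[OF cd2_graph_axioms] by auto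
  interpret twin_fibration G "2 * m - 1 + Suc n" x "{w}" f by unfold_locales (use block in auto)
  have "cd2_graph B (2 * m - 1 + n)" using B.cd2_graph_axioms by simp
  moreover have "m - 1 + n \<le> eigen_mult B 2" using eigen_mult_B Suc.prems(3) by linarith
  ultimately obtain A :: "'a pair_pre_digraph" and h where A: "cd2_graph A (2 * m - 1)" "m - 1 \<le> eigen_mult A 2"
    "graph_iso h B (cartesian_product A (hypercube n))"
    using Suc.IH[OF _ Suc.prems(2)] by blast
  then show ?case using graph_iso_unit_step[OF _ A(3)] by auto
qed

theorem theorem1p5:
  fixes G :: "'a pair_pre_digraph" and d m :: nat
  assumes "pair_graph G"
    and "Digraph_Component.connected (with_proj G)"
    and "regular_graph d G"
    and "lichnerowicz_sharp G"
    and "m > 0" and "real m \<le> real d / 2"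
    and "eigen_mult G 2 \<ge> d - m"
  shows "\<exists>B :: 'a pair_pre_digraph.
           pair_graph B \<and> Digraph_Component.connected (with_proj B) \<and>
           regular_graph (2 * m - 1) B \<and>
           digraph_iso (with_proj G)
             (with_proj (cartesian_product B (hypercube (d - 2 * m + 1)))) \<and>
           CD_inf B 2 \<and> eigen_mult B 2 \<ge> m - 1"
proof -
  have dm: "2 * m \<le> d" using assms(6) by linarith
  interpret connected_regular_graph G d by (rule connected_regular_graphI) fact+
  have pos: "0 < eigen_mult G 2" using dm assms(5,7) by linarith
  interpret cd2_graph G d
    by unfold_locales (rule lichnerowicz_sharp_CD2[OF assms(4) pos])
  define n where "n = d - 2 * m + 1"
  have d: "d = 2 * m - 1 + n" using dm assms(5) by (simp add: n_def)
  have "cd2_graph G (2 * m - 1 + n)" using cd2_graph_axioms d by simp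
  moreover have "m - 1 + n \<le> eigen_mult G 2" using assms(5,7) dm by (simp add: n_def)
  ultimately obtain B :: "'a pair_pre_digraph" and h where B: "cd2_graph B (2 * m - 1)" "m - 1 \<le> eigen_mult B 2"
    "graph_iso h G (cartesian_product B (hypercube n))"
    using hypercube_factor[OF _ assms(5)] by blast
  interpret B: cd2_graph B "2 * m - 1" by (rule B)
  have "digraph_iso (with_proj G) (with_proj (cartesian_product B (hypercube n)))"
    by (rule graph_iso_imp_digraph_iso[OF assms(1) _ B(3)]) (auto simp: cartesian_product_def)
  then show ?thesis
    using B.pair_graph_G B.connected_G B.regular_G B.cd B(2) unfolding n_def by blast
qed

end
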